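(* Let $M$ be a $d$-dimensional differentiable manifold and $j:M\to\mathbb R^k$ an embedding with $j(M)$ closed. Let $X_1,\dots,X_n$ be a random sample from a $j$-nonfocal distribution $Q$ on $M$; let $\mu=E(j(X_1))$, assume $j(X_1)$ has finite second-order moments and that the extrinsic covariance matrix $\Sigma_{j,E}$ of $X_1$ is nonsingular. Let $(e_1(p),\dots,e_k(p))$ be an orthonormal frame field adapted to $j$, defined on an open neighborhood $V$ of $P_j(\mu)$. Then a confidence region for the extrinsic mean $\mu_E$ of asymptotic level $1-\alpha$ is given by (a) $C_{n,\alpha}=j^{-1}(U_{n,\alpha})$, where $U_{n,\alpha}=\{\nu\in j(M)\cap V: n\|G(j,X)^{-1/2}\tan_{\nu}(P_j(\overline{j(X)})-\nu)\|^2\le\chi^2_{d,1-\alpha}\}$; or by (b) $D_{n,\alpha}=j^{-1}(V_{n,\alpha})$, where $V_{n,\alpha}=\{\nu\in j(M): n\|G(j,X)^{-1/2}\tan_{P_j(\overline{j(X)})}(P_j(\overline{j(X)})-\nu)\|^2\le\chi^2_{d,1-\alpha}\}$.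
   Context: A point $x\in\mathbb R^k$ is nonfocal if there is a unique point $P_j(x)\in j(M)$ closest to $x$; $P_j$ is the projection on $j(M)$. $Q$ is $j$-nonfocal if the mean $\mu$ of $j(Q)$ is nonfocal; as in the paper, $P_j$ is taken to be defined and continuously differentiable on a neighborhood of $\mu$. The extrinsic mean is $\mu_E=j^{-1}(P_j(\mu))$. $\overline{j(X)}=\frac1n\sum_{r=1}^nj(X_r)$. $e_1,\dots,e_k$ is the canonical basis of $\mathbb R^k$. A (smooth) orthonormal frame field $(e_1(p),\dots,e_k(p))$, $p\in V$, is adapted to $j$ if there is a local frame field $(f_1,\dots,f_d)$ of $M$ on $j^{-1}(V)$ with $e_r(j(x))=d_xj(f_r(x))$, $r=1,\dots,d$, for all $x\in j^{-1}(V)$. For $q\in j(M)\cap V$ and $v\in\mathbb R^k$, $\tan_q(v)=(e_1(q)^tv,\dots,e_d(q)^tv)^t$. Let $D(x)$ be the $d\times k$ matrix with $(a,b)$ entry $d_xP_j(e_b)\cdot e_a(P_j(x))$. With $\Sigma$ the covariance matrix of $j(X_1)$, the extrinsic covariance matrix is $\Sigma_{j,E}=D(\mu)\Sigma D(\mu)^t$. With $S_{j,n}=\frac1n\sum_r(j(X_r)-\overline{j(X)})(j(X_r)-\overline{j(X)})^t$, $G(j,X)=D(\overline{j(X)})\,S_{j,n}\,D(\overline{j(X)})^t$. (All quantities are well defined with probability tending to 1.) $\chi^2_{d,1-\alpha}$ is the $(1-\alpha)$th quantile of the chi-square distribution with $d$ degrees of freedom. Confidence region of asymptotic level $1-\alpha$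 means that the probability of containing $\mu_E$ tends to $1-\alpha$. *)

theory Defs
  imports "HOL-Probability.Probability"
begin

section \<open>Manifolds and embeddings\<close>

primrec C_k_on :: "nat \<Rightarrow> ('a::euclidean_space \<Rightarrow> 'b::euclidean_space) \<Rightarrow> 'a set \<Rightarrow> bool" where
  "C_k_on 0 f S \<longleftrightarrow> continuous_on S f"
| "C_k_on (Suc n) f S \<longleftrightarrow> (\<forall>x\<in>S. f differentiable at x) \<and>
     (\<forall>v. C_k_on n (\<lambda>x. frechet_derivative f (at x) v) S)"

text \<open>Only meant for open \<open>S\<close>, since the derivatives are taken at \<open>x\<close>, not within \<open>S\<close>.\<close>

definition smooth_on :: "('a::euclidean_space \<Rightarrow> 'b::euclidean_space) \<Rightarrow> 'a set \<Rightarrow> bool" where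
  "smooth_on f S \<longleftrightarrow> (\<forall>n. C_k_on n f S)"

text \<open>A chart is a pair of a domain and a coordinate map; the coordinate map is only
  relevant on the domain. The manifold is the whole type \<open>'m\<close>.\<close>

type_synonym ('m, 'd) chart = "'m set \<times> ('m \<Rightarrow> real ^ 'd)"

definition chart_inv :: "('m, 'd) chart \<Rightarrow> real ^ 'd \<Rightarrow> 'm" where
  "chart_inv c = inv_into (fst c) (snd c)"

definition smooth_atlas ::
  "('m::{t2_space, second_countable_topology}, 'd::finite) chart set \<Rightarrow> bool" where
  "smooth_atlas A \<longleftrightarrow>
     (\<Union>c\<in>A. fst c) = UNIV \<and>
     (\<forall>c\<in>A. open (fst c) \<and> open (snd c ` fst c) \<and>
        homeomorphism (fst c) (snd c ` fst c) (snd c) (chart_inv c)) \<and>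
     (\<forall>c\<in>A. \<forall>c'\<in>A. smooth_on (snd c' \<circ> chart_inv c) (snd c ` (fst c \<inter> fst c')))"

definition smooth_embedding ::
  "('m::{t2_space, second_countable_topology}, 'd::finite) chart set \<Rightarrow> ('m \<Rightarrow> real ^ 'k::finite) \<Rightarrow> bool"
  where
  "smooth_embedding A j \<longleftrightarrow>
     (\<forall>c\<in>A. smooth_on (j \<circ> chart_inv c) (snd c ` fst c)) \<and>
     (\<forall>c\<in>A. \<forall>x\<in>fst c. inj (frechet_derivative (j \<circ> chart_inv c) (at (snd c x)))) \<and>
     homeomorphism UNIV (range j) j (inv j)"

text \<open>A tangent vector at \<open>x\<close> assigns to each chart around \<open>x\<close> a coordinate vector, subject to
  the usual transformation rule; its values on other charts are irrelevant.\<close>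

definition tangent_space ::
  "('m, 'd::finite) chart set \<Rightarrow> 'm \<Rightarrow> (('m, 'd) chart \<Rightarrow> real ^ 'd) set" where
  "tangent_space A x =
     {v. \<forall>c\<in>A. \<forall>c'\<in>A. x \<in> fst c \<longrightarrow> x \<in> fst c' \<longrightarrow>
        v c' = frechet_derivative (snd c' \<circ> chart_inv c) (at (snd c x)) (v c)}"

text \<open>The differential \<open>d\<^sub>xj(v)\<close>; for tangent vectors \<open>v\<close> at \<open>x\<close> it does not depend on the
  chart selected.\<close>

definition differential ::
  "('m, 'd::finite) chart set \<Rightarrow> ('m \<Rightarrow> real ^ 'k::finite) \<Rightarrow> 'm \<Rightarrow> (('m, 'd) chart \<Rightarrow> real ^ 'd)
    \<Rightarrow> real ^ 'k" where
  "differential A j x v =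
     (let c = (SOME c. c \<in> A \<and> x \<in> fst c)
      in frechet_derivative (j \<circ> chart_inv c) (at (snd c x)) (v c))"

definition frame_field ::
  "('m, 'd::finite) chart set \<Rightarrow> 'm set \<Rightarrow> ('d \<Rightarrow> 'm \<Rightarrow> ('m, 'd) chart \<Rightarrow> real ^ 'd) \<Rightarrow> bool" where
  "frame_field A W f \<longleftrightarrow>
     (\<forall>x\<in>W. \<forall>r. f r x \<in> tangent_space A x) \<and>
     (\<forall>c\<in>A. \<forall>x\<in>W \<inter> fst c. inj (\<lambda>r. f r x c) \<and> independent (range (\<lambda>r. f r x c))) \<and>
     (\<forall>c\<in>A. \<forall>r. smooth_on (\<lambda>y. f r (chart_inv c y) c) (snd c ` (W \<inter> fst c)))"

text \<open>The index types \<open>'d\<close> and \<open>'k\<close> stand for \<open>{1..d}\<close> and \<open>{1..k}\<close>; the injection \<open>\<iota>\<close> plays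
  the role of the inclusion of the former in the latter, so that \<open>e (\<iota> r)\<close> is the \<open>r\<close>-th of
  the \<open>d\<close> tangential fields.\<close>

definition adapted_frame ::
  "('m, 'd::finite) chart set \<Rightarrow> ('m \<Rightarrow> real ^ 'k::finite) \<Rightarrow> ('d \<Rightarrow> 'k) \<Rightarrow>
    ('k \<Rightarrow> real ^ 'k \<Rightarrow> real ^ 'k) \<Rightarrow> (real ^ 'k) set \<Rightarrow> bool" where
  "adapted_frame A j \<iota> e V \<longleftrightarrow>
     (\<forall>b. smooth_on (e b) V) \<and>
     (\<forall>p\<in>V. \<forall>a b. e a p \<bullet> e b p = (if a = b then 1 else 0)) \<and>
     (\<exists>f. frame_field A (j -` V) f \<and>
        (\<forall>x\<in>j -` V. \<forall>r. e (\<iota> r) (j x) = differential A j x (f r x)))"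

section \<open>Projection and extrinsic mean\<close>

definition nonfocal :: "(real ^ 'k::finite) set \<Rightarrow> real ^ 'k \<Rightarrow> bool" where
  "nonfocal S x \<longleftrightarrow> (\<exists>!p. p \<in> S \<and> (\<forall>q\<in>S. dist x p \<le> dist x q))"

abbreviation proj :: "('m \<Rightarrow> real ^ 'k::finite) \<Rightarrow> real ^ 'k \<Rightarrow> real ^ 'k" where
  "proj j \<equiv> closest_point (range j)"

text \<open>The (open) set of points around which the projection is defined and continuously
  differentiable.\<close>

definition C1_nonfocal_points :: "('m \<Rightarrow> real ^ 'k::finite) \<Rightarrow> (real ^ 'k) set" where
  "C1_nonfocal_points j =
     {x. \<exists>N. open N \<and> x \<in> N \<and> (\<forall>y\<in>N. nonfocal (range j) y) \<and> C_k_on 1 (proj j) N}"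

definition emb_mean :: "('m \<Rightarrow> real ^ 'k::finite) \<Rightarrow> 'm measure \<Rightarrow> real ^ 'k" where
  "emb_mean j Q = (LINT x|Q. j x)"

definition emb_cov :: "('m \<Rightarrow> real ^ 'k::finite) \<Rightarrow> 'm measure \<Rightarrow> real ^ 'k ^ 'k" where
  "emb_cov j Q =
     (\<chi> a b. LINT x|Q. (j x - emb_mean j Q) $ a * (j x - emb_mean j Q) $ b)"

definition j_nonfocal :: "('m \<Rightarrow> real ^ 'k::finite) \<Rightarrow> 'm measure \<Rightarrow> bool" where
  "j_nonfocal j Q \<longleftrightarrow>
     nonfocal (range j) (emb_mean j Q) \<and> emb_mean j Q \<in> C1_nonfocal_points j"

definition extrinsic_mean :: "('m \<Rightarrow> real ^ 'k::finite) \<Rightarrow> 'm measure \<Rightarrow> 'm" where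
  "extrinsic_mean j Q = inv j (proj j (emb_mean j Q))"

definition tan_comp ::
  "('d::finite \<Rightarrow> 'k) \<Rightarrow> ('k \<Rightarrow> real ^ 'k \<Rightarrow> real ^ 'k::finite) \<Rightarrow> real ^ 'k \<Rightarrow> real ^ 'k \<Rightarrow> real ^ 'd"
  where "tan_comp \<iota> e q v = (\<chi> a. e (\<iota> a) q \<bullet> v)"

definition D_mat ::
  "('m \<Rightarrow> real ^ 'k::finite) \<Rightarrow> ('d::finite \<Rightarrow> 'k) \<Rightarrow> ('k \<Rightarrow> real ^ 'k \<Rightarrow> real ^ 'k) \<Rightarrow> real ^ 'k
    \<Rightarrow> real ^ 'k ^ 'd" where
  "D_mat j \<iota> e x =
     (\<chi> a b. frechet_derivative (proj j) (at x) (axis b 1) \<bullet> e (\<iota> a) (proj j x))"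

definition extrinsic_cov ::
  "('m \<Rightarrow> real ^ 'k::finite) \<Rightarrow> ('d::finite \<Rightarrow> 'k) \<Rightarrow> ('k \<Rightarrow> real ^ 'k \<Rightarrow> real ^ 'k) \<Rightarrow> 'm measure
    \<Rightarrow> real ^ 'd ^ 'd" where
  "extrinsic_cov j \<iota> e Q =
     D_mat j \<iota> e (emb_mean j Q) ** emb_cov j Q ** transpose (D_mat j \<iota> e (emb_mean j Q))"

section \<open>Sample quantities\<close>

text \<open>A sample of size \<open>n\<close> consists of the values \<open>x 0, \<dots>, x (n - 1)\<close> of a sequence \<open>x\<close>.\<close>

definition sample_mean :: "('m \<Rightarrow> real ^ 'k::finite) \<Rightarrow> nat \<Rightarrow> (nat \<Rightarrow> 'm) \<Rightarrow> real ^ 'k" where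
  "sample_mean j n x = (1 / real n) *\<^sub>R (\<Sum>r<n. j (x r))"

definition sample_cov :: "('m \<Rightarrow> real ^ 'k::finite) \<Rightarrow> nat \<Rightarrow> (nat \<Rightarrow> 'm) \<Rightarrow> real ^ 'k ^ 'k" where
  "sample_cov j n x = (1 / real n) *\<^sub>R
     (\<Sum>r<n. \<chi> a b. (j (x r) - sample_mean j n x) $ a * (j (x r) - sample_mean j n x) $ b)"

definition G_mat ::
  "('m \<Rightarrow> real ^ 'k::finite) \<Rightarrow> ('d::finite \<Rightarrow> 'k) \<Rightarrow> ('k \<Rightarrow> real ^ 'k \<Rightarrow> real ^ 'k) \<Rightarrow> nat
    \<Rightarrow> (nat \<Rightarrow> 'm) \<Rightarrow> real ^ 'd ^ 'd" where
  "G_mat j \<iota> e n x =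
     D_mat j \<iota> e (sample_mean j n x) ** sample_cov j n x **
     transpose (D_mat j \<iota> e (sample_mean j n x))"

text \<open>\<open>G\<^sup>-\<^sup>1\<^sup>/\<^sup>2\<close> for a symmetric positive definite \<open>G\<close>.\<close>

definition inv_sqrt :: "real ^ 'd ^ 'd \<Rightarrow> real ^ 'd ^ 'd::finite" where
  "inv_sqrt G = (THE B. transpose B = B \<and> (\<forall>v. v \<noteq> 0 \<longrightarrow> 0 < v \<bullet> (B *v v)) \<and> B ** B = matrix_inv G)"

definition chi_square :: "nat \<Rightarrow> real measure" where
  "chi_square d =
     distr (Pi\<^sub>M {..<d} (\<lambda>_. density lborel std_normal_density)) borel (\<lambda>z. \<Sum>i<d. (z i)\<^sup>2)"

definition quantile :: "real measure \<Rightarrow> real \<Rightarrow> real" where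
  "quantile M p = Inf {t. p \<le> cdf M t}"

section \<open>Confidence regions\<close>

definition region_C ::
  "('m \<Rightarrow> real ^ 'k::finite) \<Rightarrow> ('d::finite \<Rightarrow> 'k) \<Rightarrow> ('k \<Rightarrow> real ^ 'k \<Rightarrow> real ^ 'k) \<Rightarrow>
    (real ^ 'k) set \<Rightarrow> real \<Rightarrow> nat \<Rightarrow> (nat \<Rightarrow> 'm) \<Rightarrow> 'm set" where
  "region_C j \<iota> e V \<alpha> n x = j -`
     {\<nu> \<in> range j \<inter> V.
        real n * (norm (inv_sqrt (G_mat j \<iota> e n x) *v
          tan_comp \<iota> e \<nu> (proj j (sample_mean j n x) - \<nu>)))\<^sup>2
        \<le> quantile (chi_square CARD('d)) (1 - \<alpha>)}"

definition region_D ::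
  "('m \<Rightarrow> real ^ 'k::finite) \<Rightarrow> ('d::finite \<Rightarrow> 'k) \<Rightarrow> ('k \<Rightarrow> real ^ 'k \<Rightarrow> real ^ 'k) \<Rightarrow>
    real \<Rightarrow> nat \<Rightarrow> (nat \<Rightarrow> 'm) \<Rightarrow> 'm set" where
  "region_D j \<iota> e \<alpha> n x = j -`
     {\<nu> \<in> range j.
        real n * (norm (inv_sqrt (G_mat j \<iota> e n x) *v
          tan_comp \<iota> e (proj j (sample_mean j n x)) (proj j (sample_mean j n x) - \<nu>)))\<^sup>2
        \<le> quantile (chi_square CARD('d)) (1 - \<alpha>)}"

text \<open>The samples for which all ingredients of the two regions are defined. Outside of this
  set, \<open>closest_point\<close>, \<open>frechet_derivative\<close>, \<open>e\<close> and \<open>inv_sqrt\<close> may take arbitrary values.\<close>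

definition well_defined_sample ::
  "('m \<Rightarrow> real ^ 'k::finite) \<Rightarrow> ('d::finite \<Rightarrow> 'k) \<Rightarrow> ('k \<Rightarrow> real ^ 'k \<Rightarrow> real ^ 'k) \<Rightarrow>
    (real ^ 'k) set \<Rightarrow> nat \<Rightarrow> (nat \<Rightarrow> 'm) \<Rightarrow> bool" where
  "well_defined_sample j \<iota> e V n x \<longleftrightarrow>
     sample_mean j n x \<in> C1_nonfocal_points j \<and>
     proj j (sample_mean j n x) \<in> V \<and>
     invertible (G_mat j \<iota> e n x)"

text \<open>\<open>C n x\<close> is a region computed from the first \<open>n\<close> observations, and \<open>W n x\<close> says that it is
  well defined. As \<open>W\<close> holds with probability tending to 1, the asymptotic level is not
  affected by the values of \<open>C\<close> where \<open>W\<close> fails.\<close>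

definition asymptotic_confidence_region ::
  "'w measure \<Rightarrow> (nat \<Rightarrow> 'w \<Rightarrow> 'm) \<Rightarrow> (nat \<Rightarrow> (nat \<Rightarrow> 'm) \<Rightarrow> bool) \<Rightarrow>
    (nat \<Rightarrow> (nat \<Rightarrow> 'm) \<Rightarrow> 'm set) \<Rightarrow> 'm \<Rightarrow> real \<Rightarrow> bool" where
  "asymptotic_confidence_region P X W C \<theta> level \<longleftrightarrow>
     (\<forall>n. {\<omega> \<in> space P. W n (\<lambda>r. X r \<omega>)} \<in> sets P) \<and>
     (\<lambda>n. measure P {\<omega> \<in> space P. W n (\<lambda>r. X r \<omega>)}) \<longlonglongrightarrow> 1 \<and>
     (\<forall>n. {\<omega> \<in> space P. W n (\<lambda>r. X r \<omega>) \<and> \<theta> \<in> C n (\<lambda>r. X r \<omega>)} \<in> sets P) \<and>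
     (\<lambda>n. measure P {\<omega> \<in> space P. W n (\<lambda>r. X r \<omega>) \<and> \<theta> \<in> C n (\<lambda>r. X r \<omega>)}) \<longlonglongrightarrow> level"

end

theory Submission
  imports Defs
begin

text \<open>On well-defined samples \<open>\<parallel>G\<^sup>-\<^sup>1\<^sup>/\<^sup>2 t\<parallel>\<^sup>2 = t \<bullet> G\<^sup>-\<^sup>1 t\<close>, so both coverage events have the form
  \<open>n T(z) \<le> q\<close>, where \<open>z\<close> is the sample mean of \<open>(j(X), j(X) j(X)\<^sup>t)\<close> and \<open>T\<close> is continuous on the open
  set of well-defined values. Differentiability of the projection and continuity of the frame
  give \<open>T(z) = \<parallel>A (m - \<mu>)\<parallel>\<^sup>2 + o(\<parallel>m - \<mu>\<parallel>\<^sup>2)\<close> near the mean of \<open>z\<close>, where \<open>m\<close> is the first component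
  of \<open>z\<close> and \<open>A = \<Sigma>\<^sub>j\<^sub>,\<^sub>E\<^sup>-\<^sup>1\<^sup>/\<^sup>2 D(\<mu>)\<close> makes the covariance of \<open>A j(X)\<close> the identity. As
  \<open>n \<parallel>m - \<mu>\<parallel>\<^sup>2\<close> has bounded mean and \<open>z\<close> obeys the law of large numbers, the error is negligible,
  and \<open>n \<parallel>A (m - \<mu>)\<parallel>\<^sup>2\<close> converges to \<open>\<chi>\<^sup>2\<^sub>d\<close> by the central limit theorem.\<close>

text \<open>Three obstacles shape the argument. \<open>inv_sqrt\<close> is a definite description,
  so nothing can be computed from it until positive definite square roots are known to exist and to
  be unique; after the squared norm has been rewritten with \<open>matrix_inv\<close>, continuity is
  a matter of the inverse alone, whose entries are rational functions. Secondly, only second moments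
  of j(X) are available, so the matrix component of z is merely integrable: it enters through a law
  of large numbers that uses no variances, and the remainder must be measured by the first component
  alone, whose scaled mean square stays bounded. Thirdly, the central limit theorem concerns vectors
  but the statistic is a scalar; working with the law of the squared norm keeps all weak convergence
  on the real line. The two regions differ only in the point at which the frame is evaluated,
  P_j(\<mu>) or P_j(m). As P_j(m) - P_j(\<mu>) is already of first order, moving that point has an
  effect of higher order only, and one argument covers both.\<close>

section \<open>Square roots and inverses of matrices\<close>

text \<open>For large \<open>c\<close> the operator \<open>C = 1 - F / c\<close> has norm less than \<open>1\<close>, so
  \<open>Y \<mapsto> (C + Y\<^sup>2) / 2\<close> is a contraction; its fixed point satisfies \<open>(1 - Y)\<^sup>2 = F / c\<close>.\<close>
lemma self_adjoint_posdef_sqrt: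
  fixes F :: "'a::euclidean_space \<Rightarrow>\<^sub>L 'a"
  assumes sym: "\<And>x y. x \<bullet> blinfun_apply F y = blinfun_apply F x \<bullet> y"
    and pos: "\<And>x. x \<noteq> 0 \<Longrightarrow> 0 < x \<bullet> blinfun_apply F x"
  obtains B :: "'a \<Rightarrow>\<^sub>L 'a" where
    "\<And>x y. x \<bullet> blinfun_apply B y = blinfun_apply B x \<bullet> y"
    "\<And>x. x \<noteq> 0 \<Longrightarrow> 0 < x \<bullet> blinfun_apply B x"
    "B o\<^sub>L B = F"
proof -
  \<comment> \<open>Pointwise positivity becomes a uniform lower bound: the quadratic form attains
    its minimum on the compact unit sphere, and homogeneity carries the bound to all
    vectors.\<close>
  obtain m where m: "0 < m" "\<And>x. m * (norm x)\<^sup>2 \<le> x \<bullet> blinfun_apply F x"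
  proof -
    obtain b :: 'a where b: "b \<in> Basis" by (meson nonempty_Basis ex_in_conv)
    have "\<exists>x\<in>sphere (0::'a) 1. \<forall>y\<in>sphere 0 1. x \<bullet> blinfun_apply F x \<le> y \<bullet> blinfun_apply F y"
      using b by (intro continuous_attains_inf continuous_intros) (auto intro!: exI[of _ b])
    then obtain x where x: "norm x = 1" "\<And>y. norm y = 1 \<Longrightarrow> x \<bullet> blinfun_apply F x \<le> y \<bullet> blinfun_apply F y"
      by auto
    show ?thesis
    proof (rule that)
      show "0 < x \<bullet> blinfun_apply F x"
        using x(1) by (intro pos) auto
      fix y :: 'a
      show "(x \<bullet> blinfun_apply F x) * (norm y)\<^sup>2 \<le> y \<bullet> blinfun_apply F y"
      proof (cases "y = 0")
        case False
        then have "x \<bullet> blinfun_apply F x \<le> (y /\<^sub>R norm y) \<bullet> blinfun_apply F (y /\<^sub>R norm y)"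
          by (intro x(2)) auto
        also have "\<dots> = y \<bullet> blinfun_apply F y / (norm y)\<^sup>2"
          by (simp add: blinfun.scaleR_right power2_eq_square field_simps)
        finally show ?thesis
          using False by (simp add: field_simps)
      qed simp
    qed
  qed
  \<comment> \<open>Chosen so that \<open>(norm F)\<^sup>2 \<le> m * c\<close>. Then the square of
    norm (x - F x / c) is at most (1 - 2m/c + m/c) times the square of norm x, which gives the
    factor r below. The summand \<open>m\<^sup>2\<close> ensures m \<le> c, so that r is the root of
    a nonnegative number.\<close>
  define c where "c = ((norm F)\<^sup>2 + m\<^sup>2) / m"
  have c: "0 < c"
    using m(1) unfolding c_def by (auto intro!: divide_pos_pos add_nonneg_pos)
  have "m\<^sup>2 \<le> m * c"
    using m(1) by (simp add: c_def)
  then have mc: "m / c \<le> 1"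
    using c m(1) by (simp add: power2_eq_square)
  define r where "r = sqrt (1 - m / c)"
  have r: "0 \<le> r" "r < 1"
    using mc m(1) c by (auto simp: r_def real_sqrt_lt_1_iff)
  define C where "C = id_blinfun - (1 / c) *\<^sub>R F"
  have C_norm: "norm C \<le> r"
  proof (rule norm_blinfun_bound[OF r(1)])
    fix x :: 'a
    have "(norm (blinfun_apply C x))\<^sup>2 =
        (norm x)\<^sup>2 - 2 / c * (x \<bullet> blinfun_apply F x) + (norm (blinfun_apply F x))\<^sup>2 / c\<^sup>2"
      unfolding C_def power2_norm_eq_inner
      by (simp add: blinfun.diff_left blinfun.scaleR_left inner_diff_left inner_diff_right
          inner_commute power2_eq_square field_simps)
    also have "\<dots> \<le> (norm x)\<^sup>2 - 2 / c * (m * (norm x)\<^sup>2) + (norm F * norm x)\<^sup>2 / c\<^sup>2"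
      using c by (intro add_mono diff_mono mult_left_mono divide_right_mono power_mono m(2)
          norm_blinfun order_refl) auto
    also have "(norm F * norm x)\<^sup>2 / c\<^sup>2 \<le> m * c * (norm x)\<^sup>2 / c\<^sup>2"
      using m(1) by (auto simp: power_mult_distrib c_def intro!: divide_right_mono mult_right_mono)
    also have "(norm x)\<^sup>2 - 2 / c * (m * (norm x)\<^sup>2) + m * c * (norm x)\<^sup>2 / c\<^sup>2 = (r * norm x)\<^sup>2"
      using c mc by (simp add: r_def power_mult_distrib field_simps power2_eq_square)
    finally show "norm (blinfun_apply C x) \<le> r * norm x"
      using r by (auto intro: power2_le_imp_le)
  qed
  have C_sym: "x \<bullet> blinfun_apply C y = blinfun_apply C x \<bullet> y" for x y
    by (simp add: C_def blinfun.diff_left blinfun.scaleR_left inner_diff_left inner_diff_right sym)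
  \<comment> \<open>On the ball of radius r the map \<open>T\<close> is a contraction with factor r,
    and the ball is preserved because (r + r * r) / 2 \<le> r. Self-adjointness is a closed
    condition preserved by \<open>T\<close>; building it into \<open>S\<close> hands it to the fixed
    point.\<close>
  define S where "S = {Y :: 'a \<Rightarrow>\<^sub>L 'a. norm Y \<le> r \<and> (\<forall>x y. x \<bullet> blinfun_apply Y y = blinfun_apply Y x \<bullet> y)}"
  define T where "T Y = (1 / 2) *\<^sub>R (C + (Y o\<^sub>L Y))" for Y :: "'a \<Rightarrow>\<^sub>L 'a"
  have "closed S"
    unfolding S_def
    by (intro closed_Collect_conj closed_Collect_all closed_Collect_le closed_Collect_eq continuous_intros)
  note complete_eq_closed[THEN iffD2, OF this]
  moreover have "S \<noteq> {}"
    using C_norm C_sym by (auto simp: S_def)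
  moreover have "T ` S \<subseteq> S"
  proof clarify
    fix Y assume Y: "Y \<in> S"
    have "norm (Y o\<^sub>L Y) \<le> r * r"
      using Y r by (intro order_trans[OF norm_blinfun_compose] mult_mono) (auto simp: S_def)
    also have "\<dots> \<le> r"
      using r by (simp add: mult_left_le)
    finally have "norm (T Y) \<le> r"
      using norm_triangle_ineq[of C "Y o\<^sub>L Y"] C_norm by (simp add: T_def)
    moreover have "x \<bullet> blinfun_apply (T Y) y = blinfun_apply (T Y) x \<bullet> y" for x y
      using Y by (simp add: T_def S_def blinfun.add_left blinfun.scaleR_left inner_add_left
          inner_add_right C_sym)
    ultimately show "T Y \<in> S"
      by (simp add: S_def)
  qed
  moreover have "dist (T Y) (T Z) \<le> r * dist Y Z" if "Y \<in> S" "Z \<in> S" for Y Z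
  proof -
    have "T Y - T Z = (1 / 2) *\<^sub>R ((Y o\<^sub>L (Y - Z)) + ((Y - Z) o\<^sub>L Z))"
      by (rule blinfun_eqI)
        (simp add: T_def blinfun.add_left blinfun.diff_left blinfun.scaleR_left blinfun.diff_right
          scaleR_right_diff_distrib scaleR_right_distrib)
    then have "norm (T Y - T Z) \<le> (1 / 2) * (norm (Y o\<^sub>L (Y - Z)) + norm ((Y - Z) o\<^sub>L Z))"
      by (simp add: norm_triangle_ineq)
    also have "\<dots> \<le> (1 / 2) * (norm Y * norm (Y - Z) + norm (Y - Z) * norm Z)"
      by (intro mult_left_mono add_mono norm_blinfun_compose) auto
    also have "\<dots> \<le> (1 / 2) * (r * norm (Y - Z) + norm (Y - Z) * r)"
      using that by (intro mult_left_mono mult_right_mono add_mono) (auto simp: S_def)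
    finally show ?thesis
      by (simp add: dist_norm)
  qed
  ultimately obtain Y where Y: "Y \<in> S" "T Y = Y"
    using Banach_fix[of S r T] r by blast
  define B where "B = sqrt c *\<^sub>R (id_blinfun - Y)"
  show ?thesis
  proof (rule that)
    show "x \<bullet> blinfun_apply B y = blinfun_apply B x \<bullet> y" for x y
      using Y(1) by (simp add: B_def S_def blinfun.diff_left blinfun.scaleR_left inner_diff_left
          inner_diff_right)
    show "0 < x \<bullet> blinfun_apply B x" if "x \<noteq> 0" for x
    proof -
      have "x \<bullet> blinfun_apply Y x \<le> norm x * (norm Y * norm x)"
        by (intro order_trans[OF norm_cauchy_schwarz] mult_left_mono norm_blinfun) auto
      also have "\<dots> \<le> r * (norm x)\<^sup>2"
        using Y(1) mult_right_mono[of "norm Y" r "(norm x)\<^sup>2"]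
        by (simp add: S_def power2_eq_square mult.left_commute)
      also have "\<dots> < x \<bullet> x"
        using r that by (simp add: power2_norm_eq_inner)
      finally show ?thesis
        using c by (simp add: B_def blinfun.diff_left blinfun.scaleR_left inner_diff_right)
    qed
    show "B o\<^sub>L B = F"
    proof (rule blinfun_eqI)
      fix x
      have "2 *\<^sub>R blinfun_apply (T Y) x = blinfun_apply C x + blinfun_apply Y (blinfun_apply Y x)"
        by (simp add: T_def blinfun.add_left blinfun.scaleR_left)
      then have "blinfun_apply Y (blinfun_apply Y x) = 2 *\<^sub>R blinfun_apply Y x - x + (1 / c) *\<^sub>R blinfun_apply F x"
        unfolding Y(2) by (simp add: C_def blinfun.diff_left blinfun.scaleR_left algebra_simps)
      then have "x - 2 *\<^sub>R blinfun_apply Y x + blinfun_apply Y (blinfun_apply Y x) = (1 / c) *\<^sub>R blinfun_apply F x"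
        by simp
      moreover have "blinfun_apply (B o\<^sub>L B) x = (sqrt c * sqrt c) *\<^sub>R
          (x - 2 *\<^sub>R blinfun_apply Y x + blinfun_apply Y (blinfun_apply Y x))"
        by (simp only: B_def blinfun_apply_blinfun_compose blinfun.diff_left blinfun.scaleR_left
            blinfun.diff_right blinfun.scaleR_right id_blinfun.rep_eq id_apply scaleR_scaleR)
          (simp add: scaleR_2 algebra_simps)
      ultimately have "blinfun_apply (B o\<^sub>L B) x = c *\<^sub>R ((1 / c) *\<^sub>R blinfun_apply F x)"
        using c by simp
      then show "blinfun_apply (B o\<^sub>L B) x = blinfun_apply F x"
        using c by simp
    qed
  qed
qed

lemma inner_matrix_vector_mult:
  fixes A :: "real ^ 'n ^ 'm"
  shows "x \<bullet> (A *v y) = (transpose A *v x) \<bullet> y"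
  by (simp add: dot_lmul_matrix transpose_matrix_vector)

text \<open>For square roots \<open>B\<close> and \<open>B'\<close> of the same matrix, \<open>E = B - B'\<close> satisfies \<open>B E + E B' = 0\<close>.
  Hence \<open>tr (E B E) + tr (E B' E) = 0\<close>, and both traces are nonnegative.\<close>
lemma posdef_sqrt_unique:
  fixes B B' :: "real ^ 'n ^ 'n"
  assumes sym: "transpose B = B" "transpose B' = B'"
    and pos: "\<And>v. v \<noteq> 0 \<Longrightarrow> 0 < v \<bullet> (B *v v)" "\<And>v. v \<noteq> 0 \<Longrightarrow> 0 < v \<bullet> (B' *v v)"
    and eq: "B ** B = B' ** B'"
  shows "B = B'"
proof -
  define E where "E = B - B'"
  have symE: "transpose E = E"
    using sym by (simp add: E_def transpose_def vec_eq_iff)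
  \<comment> \<open>The trace becomes a sum of values of the quadratic form of \<open>A\<close> at
    the columns of \<open>E\<close>; if \<open>A\<close> is positive definite and the trace is zero,
    every column vanishes.\<close>
  have tr: "trace (E ** (A ** E)) = (\<Sum>i\<in>UNIV. (E *v axis i 1) \<bullet> (A *v (E *v axis i 1)))"
    for A :: "real ^ 'n ^ 'n"
  proof -
    have "(E *v axis i 1) \<bullet> (A *v (E *v axis i 1)) = (E ** (A ** E)) $ i $ i" for i
    proof -
      have "(E ** (A ** E)) $ i $ i = axis i 1 \<bullet> ((E ** (A ** E)) *v axis i 1)"
        by (simp add: inner_axis' matrix_vector_mul_component inner_axis)
      also have "\<dots> = axis i 1 \<bullet> (E *v (A *v (E *v axis i 1)))"
        by (simp add: matrix_vector_mul_assoc matrix_mul_assoc)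
      also have "\<dots> = (E *v axis i 1) \<bullet> (A *v (E *v axis i 1))"
        by (subst inner_matrix_vector_mult) (simp add: symE)
      finally show ?thesis ..
    qed
    then show ?thesis by (simp add: trace_def)
  qed
  have "B ** E + E ** B' = 0"
    using eq unfolding matrix_eq E_def
    by (simp add: matrix_vector_mul_assoc[symmetric] algebra_simps)
  then have "trace ((B ** E + E ** B') ** E) = 0"
    by (simp add: trace_def)
  moreover have distr: "(B ** E + E ** B') ** E = B ** E ** E + E ** B' ** E"
    unfolding matrix_eq by (simp add: matrix_vector_mul_assoc[symmetric] algebra_simps)
  ultimately have "trace (B ** E ** E) + trace (E ** B' ** E) = 0"
    by (simp add: distr trace_add)
  then have "trace (B ** E ** E) + trace (E ** (B' ** E)) = 0"
    by (simp add: matrix_mul_assoc)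
  moreover have "trace (B ** E ** E) = trace (E ** (B ** E))"
    by (rule trace_mul_sym)
  ultimately have "(\<Sum>i\<in>UNIV. (E *v axis i 1) \<bullet> (B *v (E *v axis i 1)))
      + (\<Sum>i\<in>UNIV. (E *v axis i 1) \<bullet> (B' *v (E *v axis i 1))) = 0"
    by (simp add: tr)
  moreover have nn: "0 \<le> v \<bullet> (B *v v)" "0 \<le> v \<bullet> (B' *v v)" for v
    using pos[of v] by (cases "v = 0"; simp add: less_imp_le)+
  ultimately have "(\<Sum>i\<in>UNIV. (E *v axis i 1) \<bullet> (B *v (E *v axis i 1))) = 0"
    using sum_nonneg[of UNIV "\<lambda>i. (E *v axis i 1) \<bullet> (B *v (E *v axis i 1))"]
      sum_nonneg[of UNIV "\<lambda>i. (E *v axis i 1) \<bullet> (B' *v (E *v axis i 1))"] by simp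
  then have "(E *v axis i 1) \<bullet> (B *v (E *v axis i 1)) = 0" for i
    using nn by (subst (asm) sum_nonneg_eq_0_iff) auto
  then have "E *v axis i 1 = 0" for i
    using pos(1)[of "E *v axis i 1"] by fastforce
  then have "E = 0"
    by (simp add: vec_eq_iff matrix_vector_mul_component inner_axis)
  then show ?thesis by (simp add: E_def)
qed

lemma matrix_inv_mult:
  assumes "invertible A"
  shows "A ** matrix_inv A = mat 1" "matrix_inv A ** A = mat 1"
  using someI_ex[of "\<lambda>A'. A ** A' = mat 1 \<and> A' ** A = mat 1"] assms
  by (auto simp: invertible_def matrix_inv_def)

text \<open>Existence and uniqueness of the root are applied to H = G^-1, which inherits symmetry
  and positivity: since v = G (H v), the value of v \<bullet> H v is the form of G at H v. Only then
  does the description in \<open>inv_sqrt\<close> denote something.\<close>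

lemma inv_sqrt_posdef:
  fixes G :: "real ^ 'n ^ 'n"
  assumes sym: "transpose G = G" and pos: "\<And>v. v \<noteq> 0 \<Longrightarrow> 0 < v \<bullet> (G *v v)"
  shows "transpose (inv_sqrt G) = inv_sqrt G" "inv_sqrt G ** inv_sqrt G = matrix_inv G"
    "invertible G"
proof -
  have "v = 0" if "G *v v = 0" for v
    using pos[of v] that by fastforce
  then show inv: "invertible G"
    by (meson invertible_left_inverse matrix_left_invertible_ker)
  define H where "H = matrix_inv G"
  have GH: "G ** H = mat 1" and HG: "H ** G = mat 1"
    using matrix_inv_mult[OF inv] by (auto simp: H_def)
  have "transpose H ** G = transpose (G ** H)"
    by (simp add: matrix_transpose_mul sym)
  then have "transpose H ** G ** H = H"
    by (simp add: GH transpose_mat)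
  then have symH: "transpose H = H"
    by (simp add: GH matrix_mul_assoc[symmetric])
  have posH: "0 < v \<bullet> (H *v v)" if "v \<noteq> 0" for v
  proof -
    have v: "G *v (H *v v) = v"
      by (simp add: matrix_vector_mul_assoc GH)
    then have "H *v v \<noteq> 0" using that by auto
    from pos[OF this] show ?thesis by (simp add: v inner_commute)
  qed
  define F where "F = Blinfun ((*v) H)"
  have F: "blinfun_apply F = (*v) H"
    unfolding F_def by (rule bounded_linear_Blinfun_apply) simp
  obtain B where B: "\<And>x y. x \<bullet> blinfun_apply B y = blinfun_apply B x \<bullet> y"
    "\<And>x. x \<noteq> 0 \<Longrightarrow> 0 < x \<bullet> blinfun_apply B x" "B o\<^sub>L B = F"
    by (rule self_adjoint_posdef_sqrt[of F])
      (simp add: F inner_matrix_vector_mult symH, simp add: F posH, blast)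
  define M where "M = matrix (blinfun_apply B)"
  have M: "M *v v = blinfun_apply B v" for v
    unfolding M_def by (rule matrix_works) (simp add: linear_matrix_vector_mul_eq blinfun.bounded_linear_right bounded_linear.linear)
  have "transpose M *v y = M *v y" for y
    by (rule vector_eq_rdot[THEN iffD1])
      (metis B(1) M inner_commute inner_matrix_vector_mult)
  then have M1: "transpose M = M"
    by (simp add: matrix_eq)
  have M3: "M ** M = H"
    unfolding matrix_eq matrix_vector_mul_assoc[symmetric] M
    using B(3) F by (metis blinfun_apply_blinfun_compose)
  have "\<exists>!B. transpose B = B \<and> (\<forall>v. v \<noteq> 0 \<longrightarrow> 0 < v \<bullet> (B *v v)) \<and> B ** B = matrix_inv G"
  proof (rule ex1I[of _ M])
    show M_sqrt: "transpose M = M \<and> (\<forall>v. v \<noteq> 0 \<longrightarrow> 0 < v \<bullet> (M *v v)) \<and> M ** M = matrix_inv G"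
      using M1 M3 B(2) by (simp add: M H_def)
    fix C
    assume C: "transpose C = C \<and> (\<forall>v. v \<noteq> 0 \<longrightarrow> 0 < v \<bullet> (C *v v)) \<and> C ** C = matrix_inv G"
    show "C = M"
    proof (rule posdef_sqrt_unique)
      show "C ** C = M ** M"
        by (rule trans[OF conjunct2[OF conjunct2[OF C]] conjunct2[OF conjunct2[OF M_sqrt], symmetric]])
    qed (use C M_sqrt in blast)+
  qed
  from theI'[OF this] show "transpose (inv_sqrt G) = inv_sqrt G" "inv_sqrt G ** inv_sqrt G = matrix_inv G"
    by (auto simp: inv_sqrt_def)
qed

text \<open>Eliminates the square root from the statistic, leaving the inverse, whose continuity is
  accessible through determinants.\<close>

lemma norm_inv_sqrt:
  fixes G :: "real ^ 'n ^ 'n"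
  assumes "transpose G = G" "\<And>v. v \<noteq> 0 \<Longrightarrow> 0 < v \<bullet> (G *v v)"
  shows "(norm (inv_sqrt G *v v))\<^sup>2 = v \<bullet> (matrix_inv G *v v)"
  using inv_sqrt_posdef[OF assms]
  by (metis inner_matrix_vector_mult matrix_vector_mul_assoc power2_norm_eq_inner)

text \<open>If the form vanishes at v, then along v + t w with w = G v it equals t^2 (w \<bullet> G
  w) + 2 t (w \<bullet> w). For small negative t the linear term would win, so w = 0, against
  invertibility. This is how invertibility of \<open>G_mat\<close> and of the extrinsic covariance
  yields definiteness.\<close>

lemma psd_invertible_imp_posdef:
  fixes G :: "real ^ 'n ^ 'n"
  assumes sym: "transpose G = G" and psd: "\<And>v. 0 \<le> v \<bullet> (G *v v)" and inv: "invertible G"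
    and "v \<noteq> 0"
  shows "0 < v \<bullet> (G *v v)"
proof (rule ccontr)
  assume "\<not> ?thesis"
  with psd[of v] have 0: "v \<bullet> (G *v v) = 0" by simp
  define w where "w = G *v v"
  have *: "0 \<le> t\<^sup>2 * (w \<bullet> (G *v w)) + 2 * t * (w \<bullet> w)" for t
    using psd[of "v + t *\<^sub>R w"] 0
    by (simp add: inner_add_left inner_add_right matrix_vector_right_distrib
        matrix_vector_mult_scaleR w_def[symmetric] inner_matrix_vector_mult[of v] sym power2_eq_square algebra_simps)
  have "w \<bullet> w = 0"
  proof (rule ccontr)
    assume w: "w \<bullet> w \<noteq> 0"
    \<comment> \<open>The minimiser of the quadratic polynomial in t, with 1 added to the leading
      coefficient because that coefficient may be zero.\<close>
    define t where "t = - (w \<bullet> w) / (w \<bullet> (G *v w) + 1)"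
    define q where "q = w \<bullet> (G *v w) + 1"
    define s where "s = w \<bullet> w"
    have q: "q \<ge> 1" and s: "s > 0"
      using psd[of w] w by (auto simp: q_def s_def less_le)
    have "t\<^sup>2 * (q - 1) + 2 * t * s = - (s\<^sup>2 * (q + 1) / q\<^sup>2)"
      using q unfolding t_def q_def[symmetric] s_def[symmetric]
      by (simp add: power2_eq_square field_simps)
    moreover have "s\<^sup>2 * (q + 1) / q\<^sup>2 > 0"
      using q s by simp
    ultimately show False using *[of t] by (simp add: q_def s_def)
  qed
  then have "G *v v = 0" by (simp add: w_def)
  then show False
    using inv \<open>v \<noteq> 0\<close> by (metis invertible_left_inverse matrix_left_invertible_ker)
qed

section \<open>Continuity of matrix operations and a norm bound\<close>

lemma continuous_on_det:
  fixes A :: "'a::topological_space \<Rightarrow> real ^ 'n ^ 'n"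
  assumes "\<And>i l. continuous_on S (\<lambda>x. A x $ i $ l)"
  shows "continuous_on S (\<lambda>x. det (A x))"
  unfolding det_def by (intro continuous_intros assms)

text \<open>Cramer's rule, solved for the columns of the inverse. It exhibits each entry as a
  quotient of determinants, hence as a continuous function of \<open>A\<close> wherever
  \<open>A\<close> is invertible.\<close>

lemma matrix_inv_nth:
  fixes A :: "real ^ 'n ^ 'n"
  assumes "det A \<noteq> 0"
  shows "matrix_inv A $ i $ l =
    det (\<chi> a b. if b = i then axis l 1 $ a else A $ a $ b) / det A"
proof -
  have "A *v (matrix_inv A *v axis l 1) = axis l 1"
    using matrix_inv_mult(1)[of A] assms by (simp add: matrix_vector_mul_assoc invertible_det_nz)
  then have "matrix_inv A *v axis l 1 = (\<chi> k. det (\<chi> i j. if j = k then axis l 1 $ i else A $ i $ j) / det A)"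
    using cramer[OF assms] by blast
  moreover have "matrix_inv A $ i $ l = (matrix_inv A *v axis l 1) $ i"
    by (simp add: matrix_vector_mul_component inner_axis)
  ultimately show ?thesis by simp
qed

lemma continuous_on_matrix_inv:
  fixes A :: "'a::topological_space \<Rightarrow> real ^ 'n ^ 'n"
  assumes A: "continuous_on S A" and inv: "\<And>x. x \<in> S \<Longrightarrow> invertible (A x)"
  shows "continuous_on S (\<lambda>x. matrix_inv (A x))"
proof -
  have comp: "continuous_on S (\<lambda>x. A x $ i $ l)" for i l
    using A by (intro continuous_intros)
  have det: "det (A x) \<noteq> 0" if "x \<in> S" for x
    using inv[OF that] by (simp add: invertible_det_nz)
  have "continuous_on S (\<lambda>x. det (\<chi> a b. if b = i then axis l 1 $ a else A x $ a $ b))" for i l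
  proof (rule continuous_on_det)
    show "continuous_on S (\<lambda>x. (\<chi> a b. if b = i then axis l 1 $ a else A x $ a $ b) $ a $ b)" for a b
      using comp by (cases "b = i") auto
  qed
  then have "continuous_on S (\<lambda>x. det (\<chi> a b. if b = i then axis l 1 $ a else A x $ a $ b) / det (A x))" for i l
    by (intro continuous_on_divide continuous_on_det[OF comp]) (auto simp: det)
  then have "continuous_on S (\<lambda>x. matrix_inv (A x) $ i $ l)" for i l
    by (rule continuous_on_cong[THEN iffD1, rotated -1]) (simp_all add: matrix_inv_nth det)
  then show ?thesis
    by (intro continuous_on_vec_lambda[where f = "\<lambda>i x. matrix_inv (A x) $ i", simplified]
        continuous_on_vec_lambda[where f = "\<lambda>l x. matrix_inv (A x) $ _ $ l", simplified])
qed

lemma continuous_on_matrix_mult: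
  fixes A :: "'a::topological_space \<Rightarrow> real ^ 'n ^ 'm" and B :: "'a \<Rightarrow> real ^ 'l ^ 'n"
  assumes "continuous_on S A" "continuous_on S B"
  shows "continuous_on S (\<lambda>x. A x ** B x)"
  unfolding matrix_matrix_mult_def using assms by (intro continuous_intros)

lemma continuous_on_transpose:
  fixes A :: "'a::topological_space \<Rightarrow> real ^ 'n ^ 'm"
  shows "continuous_on S A \<Longrightarrow> continuous_on S (\<lambda>x. transpose (A x))"
  unfolding transpose_def by (intro continuous_intros)

lemma continuous_on_matrix_vector_mult:
  fixes A :: "'a::topological_space \<Rightarrow> real ^ 'n ^ 'm"
  assumes "continuous_on S A" "continuous_on S f"
  shows "continuous_on S (\<lambda>x. A x *v f x)"
  unfolding matrix_vector_mult_def using assms by (intro continuous_intros)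

text \<open>The norm of a matrix is here the Euclidean norm of its entries, so Cauchy-Schwarz in
  each row suffices.\<close>

lemma norm_matrix_vector_mult_le:
  fixes A :: "real ^ 'n ^ 'm"
  shows "norm (A *v x) \<le> norm A * norm x"
proof -
  have "norm (A *v x) \<le> L2_set (\<lambda>i. norm (A $ i) * norm x) UNIV"
    unfolding norm_vec_def[of "A *v x"]
    by (intro L2_set_mono) (auto simp: matrix_vector_mul_component Cauchy_Schwarz_ineq2)
  also have "\<dots> = norm A * norm x"
    by (simp add: norm_vec_def[of A] L2_set_left_distrib)
  finally show ?thesis .
qed

section \<open>Law of large numbers\<close>

text \<open>Each new variable is independent of the preceding partial sum and centred, so the cross
  term has expectation zero.\<close>

lemma (in prob_space) second_moment_sum:
  fixes Y :: "nat \<Rightarrow> 'a \<Rightarrow> real"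
  assumes indep: "indep_vars (\<lambda>_. borel) Y UNIV"
    and sq: "\<And>i. integrable M (\<lambda>\<omega>. (Y i \<omega>)\<^sup>2)"
    and mean: "\<And>i. expectation (Y i) = 0"
  shows "integrable M (\<lambda>\<omega>. (\<Sum>i<n. Y i \<omega>)\<^sup>2)"
    and "expectation (\<lambda>\<omega>. (\<Sum>i<n. Y i \<omega>)\<^sup>2) = (\<Sum>i<n. expectation (\<lambda>\<omega>. (Y i \<omega>)\<^sup>2))"
proof -
  have [measurable]: "random_variable borel (Y i)" for i
    using indep by (simp add: indep_vars_def)
  have int: "integrable M (Y i)" for i
    by (rule square_integrable_imp_integrable[OF _ sq]) simp
  have "integrable M (\<lambda>\<omega>. (\<Sum>i<n. Y i \<omega>)\<^sup>2) \<and>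
    expectation (\<lambda>\<omega>. (\<Sum>i<n. Y i \<omega>)\<^sup>2) = (\<Sum>i<n. expectation (\<lambda>\<omega>. (Y i \<omega>)\<^sup>2))"
  proof (induction n)
    case (Suc n)
    define S where "S = (\<lambda>\<omega>. \<Sum>i<n. Y i \<omega>)"
    have ind: "indep_var borel (Y n) borel S"
      unfolding S_def
      by (rule indep_vars_sum) (auto intro: indep_vars_subset[OF indep])
    have intS: "integrable M S"
      unfolding S_def by (intro Bochner_Integration.integrable_sum int)
    have prod: "integrable M (\<lambda>\<omega>. Y n \<omega> * S \<omega>)" "expectation (\<lambda>\<omega>. Y n \<omega> * S \<omega>) = 0"
      using indep_var_integrable[OF ind int intS] indep_var_lebesgue_integral[OF ind int intS] mean
      by auto
    have IH: "integrable M (\<lambda>\<omega>. (S \<omega>)\<^sup>2)"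
      "expectation (\<lambda>\<omega>. (S \<omega>)\<^sup>2) = (\<Sum>i<n. expectation (\<lambda>\<omega>. (Y i \<omega>)\<^sup>2))"
      using Suc by (auto simp: S_def)
    have eq: "(\<Sum>i<Suc n. Y i \<omega>)\<^sup>2 = (S \<omega>)\<^sup>2 + 2 * (Y n \<omega> * S \<omega>) + (Y n \<omega>)\<^sup>2" for \<omega>
      by (simp add: S_def power2_sum algebra_simps)
    show ?case
      unfolding eq using IH prod sq by simp
  qed simp
  then show "integrable M (\<lambda>\<omega>. (\<Sum>i<n. Y i \<omega>)\<^sup>2)"
    "expectation (\<lambda>\<omega>. (\<Sum>i<n. Y i \<omega>)\<^sup>2) = (\<Sum>i<n. expectation (\<lambda>\<omega>. (Y i \<omega>)\<^sup>2))"
    by auto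
qed

text \<open>Truncate at a level \<open>K\<close>: the truncated variables are square integrable, and the rest is
  small in mean.\<close>
lemma (in prob_space) lln_L1_real:
  fixes Y :: "nat \<Rightarrow> 'a \<Rightarrow> real"
  assumes indep: "indep_vars (\<lambda>_. borel) Y UNIV"
    and distr: "\<And>i. distr M borel (Y i) = N"
    and int: "integrable N (\<lambda>y. y)"
  shows "(\<lambda>n. expectation (\<lambda>\<omega>. \<bar>(\<Sum>i<n. Y i \<omega>) / real n - (LINT y|N. y)\<bar>)) \<longlonglongrightarrow> 0"
proof (rule tendstoI)
  have Y[measurable]: "random_variable borel (Y i)" for i
    using indep by (simp add: indep_vars_def)
  have sets_N[measurable_cong]: "sets N = sets borel"
    using distr[of 0] by auto
  have integral_N: "expectation (\<lambda>\<omega>. g (Y i \<omega>)) = integral\<^sup>L N g"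
    and integrable_N: "integrable M (\<lambda>\<omega>. g (Y i \<omega>)) \<longleftrightarrow> integrable N g"
    if "g \<in> borel_measurable borel" for i and g :: "real \<Rightarrow> real"
    using that unfolding distr[of i, symmetric] by (auto simp: integral_distr integrable_distr_eq)
  interpret N: prob_space N
    unfolding distr[of 0, symmetric] by (rule prob_space_distr) simp
  define c where "c = (LINT y|N. y)"
  fix e :: real assume e: "0 < e"
  \<comment> \<open>Four errors of this size occur: the truncation remainder in mean, its effect on
    the limit c, the slack in the passage from absolute value to square, and, for large n, the
    variance of the truncated average. A fifth share makes the inequality strict.\<close>
  define \<epsilon> where "\<epsilon> = e / 5"
  have \<epsilon>: "0 < \<epsilon>" using e by (simp add: \<epsilon>_def)
  define g where "g K y = (if \<bar>y\<bar> \<le> K then y else 0)" for K y :: real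
  have g[measurable]: "g K \<in> borel_measurable borel" for K
    unfolding g_def by measurable
  have "(\<lambda>K. LINT y|N. \<bar>y - g (real K) y\<bar>) \<longlonglongrightarrow> (LINT y|N. 0)"
  proof (rule integral_dominated_convergence[where w = "\<lambda>y. \<bar>y\<bar>"])
    show "AE y in N. (\<lambda>K. \<bar>y - g (real K) y\<bar>) \<longlonglongrightarrow> 0"
    proof (rule AE_I2, rule tendsto_eventually)
      fix y :: real
      show "\<forall>\<^sub>F K in sequentially. \<bar>y - g (real K) y\<bar> = 0"
        using eventually_ge_at_top[of "nat \<lceil>\<bar>y\<bar>\<rceil>"]
        by eventually_elim (auto simp: g_def nat_ceiling_le_eq)
    qed
    show "integrable N abs" using int by simp
  qed (auto simp: g_def)
  then have "\<forall>\<^sub>F K in sequentially. (LINT y|N. \<bar>y - g (real K) y\<bar>) < \<epsilon>"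
    using \<epsilon> by (intro order_tendstoD(2)) auto
  then obtain K :: nat where K: "(LINT y|N. \<bar>y - g (real K) y\<bar>) < \<epsilon>"
    using eventually_happens by fastforce
  define h where "h = g (real K)"
  have h[measurable]: "h \<in> borel_measurable borel" and h_le: "\<bar>h y\<bar> \<le> K" for y
    by (auto simp: h_def g_def)
  have int_h: "integrable N h"
    by (rule N.integrable_const_bound[of _ K]) (auto simp: h_le)
  define b where "b = integral\<^sup>L N h"
  have b: "\<bar>b\<bar> \<le> K"
  proof -
    have "\<bar>b\<bar> \<le> (LINT y|N. \<bar>h y\<bar>)"
      unfolding b_def by (rule integral_abs_bound)
    also have "\<dots> \<le> (LINT y|N. K)"
      using int_h by (intro integral_mono) (auto simp: h_le)
    finally show ?thesis by (simp add: N.prob_space)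
  qed
  define Z where "Z i \<omega> = h (Y i \<omega>) - b" for i \<omega>
  have Z_le: "\<bar>Z i \<omega>\<bar> \<le> 2 * K" for i \<omega>
    using h_le[of "Y i \<omega>"] b by (simp add: Z_def)
  have Z_sq_le: "(Z i \<omega>)\<^sup>2 \<le> (real (2 * K))\<^sup>2" for i \<omega>
    using Z_le[of i \<omega>] by (intro abs_le_square_iff[THEN iffD1]) simp
  have [measurable]: "random_variable borel (Z i)" for i
    unfolding Z_def by measurable
  have Z_sq: "integrable M (\<lambda>\<omega>. (Z i \<omega>)\<^sup>2)" for i
    by (rule integrable_const_bound[of _ "(real (2 * K))\<^sup>2"]) (use Z_sq_le in auto)
  have "indep_vars (\<lambda>_. borel) Z UNIV"
    unfolding Z_def
    by (rule indep_vars_compose2[OF indep, where Y = "\<lambda>_ y. h y - b"]) measurable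
  moreover have "expectation (Z i) = 0" for i
    unfolding Z_def using integral_N[OF h, of i] integrable_N[OF h, of i] int_h
    by (simp add: b_def prob_space)
  ultimately have sumZ: "integrable M (\<lambda>\<omega>. (\<Sum>i<n. Z i \<omega>)\<^sup>2)"
    "expectation (\<lambda>\<omega>. (\<Sum>i<n. Z i \<omega>)\<^sup>2) = (\<Sum>i<n. expectation (\<lambda>\<omega>. (Z i \<omega>)\<^sup>2))" for n
    using second_moment_sum[of Z] Z_sq by auto
  have sumZ_le: "expectation (\<lambda>\<omega>. (\<Sum>i<n. Z i \<omega>)\<^sup>2) \<le> real n * (real (2 * K))\<^sup>2" for n
  proof -
    have "expectation (\<lambda>\<omega>. (Z i \<omega>)\<^sup>2) \<le> (real (2 * K))\<^sup>2" for i
    proof -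
      have "expectation (\<lambda>\<omega>. (Z i \<omega>)\<^sup>2) \<le> expectation (\<lambda>_. (real (2 * K))\<^sup>2)"
        by (intro integral_mono Z_sq) (use Z_sq_le in auto)
      then show ?thesis by (simp add: prob_space)
    qed
    then show ?thesis
      unfolding sumZ(2) using sum_bounded_above[of "{..<n}" "\<lambda>i. expectation (\<lambda>\<omega>. (Z i \<omega>)\<^sup>2)"] by simp
  qed
  have intY: "integrable M (Y i)" for i
    by (rule integrable_N[THEN iffD2, OF _ int]) simp
  have int_rest: "integrable M (\<lambda>\<omega>. \<bar>Y i \<omega> - h (Y i \<omega>)\<bar>)" for i
    using intY integrable_N[OF h, of i] int_h by simp
  have exp_rest: "expectation (\<lambda>\<omega>. \<bar>Y i \<omega> - h (Y i \<omega>)\<bar>) \<le> \<epsilon>" for i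
    using integral_N[of "\<lambda>y. \<bar>y - h y\<bar>" i] K by (simp add: h_def)
  have bc: "\<bar>b - c\<bar> \<le> \<epsilon>"
  proof -
    have "\<bar>c - b\<bar> = \<bar>LINT y|N. y - h y\<bar>"
      using int int_h by (simp add: b_def c_def)
    also have "\<dots> \<le> (LINT y|N. \<bar>y - h y\<bar>)" by (rule integral_abs_bound)
    finally show ?thesis using K by (simp add: h_def)
  qed
  have bound: "expectation (\<lambda>\<omega>. \<bar>(\<Sum>i<n. Y i \<omega>) / real n - c\<bar>) \<le> (real (2 * K))\<^sup>2 / \<epsilon> / real n + 3 * \<epsilon>"
    if n: "0 < n" for n
  proof -
    have pointwise: "\<bar>(\<Sum>i<n. Y i \<omega>) / real n - c\<bar> \<le>
      (\<Sum>i<n. Z i \<omega>)\<^sup>2 / (\<epsilon> * (real n)\<^sup>2) + (\<Sum>i<n. \<bar>Y i \<omega> - h (Y i \<omega>)\<bar>) / real n + 2 * \<epsilon>" for \<omega>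
    proof -
      have "(\<Sum>i<n. Y i \<omega>) / real n - c =
        (\<Sum>i<n. Z i \<omega>) / real n + (\<Sum>i<n. Y i \<omega> - h (Y i \<omega>)) / real n + (b - c)"
        using n by (simp add: Z_def sum_subtractf diff_divide_distrib)
      also have "\<bar>\<dots>\<bar> \<le> \<bar>(\<Sum>i<n. Z i \<omega>) / real n\<bar> + (\<Sum>i<n. \<bar>Y i \<omega> - h (Y i \<omega>)\<bar>) / real n + \<epsilon>"
      proof -
        have "\<bar>(\<Sum>i<n. Y i \<omega> - h (Y i \<omega>)) / real n\<bar> \<le> (\<Sum>i<n. \<bar>Y i \<omega> - h (Y i \<omega>)\<bar>) / real n"
          by (simp add: divide_right_mono sum_abs)
        then show ?thesis using bc by linarith
      qed
      \<comment> \<open>Weighted arithmetic-geometric inequality: the absolute value is traded for a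
        square plus \<epsilon>, so that the second moment of the truncated sum controls its first
        absolute moment.\<close>
      also have "\<bar>(\<Sum>i<n. Z i \<omega>) / real n\<bar> \<le> ((\<Sum>i<n. Z i \<omega>) / real n)\<^sup>2 / \<epsilon> + \<epsilon>"
      proof -
        have "\<bar>a\<bar> \<le> a\<^sup>2 / \<epsilon> + \<epsilon>" for a :: real
        proof -
          have "\<bar>a\<bar> * \<epsilon> \<le> 2 * \<bar>a\<bar> * \<epsilon>"
            using \<epsilon> by simp
          also have "\<dots> \<le> a\<^sup>2 + \<epsilon>\<^sup>2"
            using sum_squares_bound[of "\<bar>a\<bar>" \<epsilon>] by simp
          finally show ?thesis
            using \<epsilon> by (simp add: field_simps power2_eq_square)
        qed
        then show ?thesis by blast
      qed
      finally show ?thesis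
        by (simp add: power_divide mult.commute)
    qed
    have "expectation (\<lambda>\<omega>. \<bar>(\<Sum>i<n. Y i \<omega>) / real n - c\<bar>) \<le>
      expectation (\<lambda>\<omega>. (\<Sum>i<n. Z i \<omega>)\<^sup>2 / (\<epsilon> * (real n)\<^sup>2) + (\<Sum>i<n. \<bar>Y i \<omega> - h (Y i \<omega>)\<bar>) / real n + 2 * \<epsilon>)"
      by (intro integral_mono pointwise integrable_abs Bochner_Integration.integrable_add
          Bochner_Integration.integrable_diff integrable_divide_zero Bochner_Integration.integrable_sum
          intY sumZ int_rest) auto
    also have "\<dots> = expectation (\<lambda>\<omega>. (\<Sum>i<n. Z i \<omega>)\<^sup>2) / (\<epsilon> * (real n)\<^sup>2)
      + (\<Sum>i<n. expectation (\<lambda>\<omega>. \<bar>Y i \<omega> - h (Y i \<omega>)\<bar>)) / real n + 2 * \<epsilon>"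
      using sumZ(1) int_rest by (simp add: prob_space)
    also have "\<dots> \<le> (real n * (real (2 * K))\<^sup>2) / (\<epsilon> * (real n)\<^sup>2) + (real n * \<epsilon>) / real n + 2 * \<epsilon>"
      using \<epsilon> n sum_bounded_above[of "{..<n}" "\<lambda>i. expectation (\<lambda>\<omega>. \<bar>Y i \<omega> - h (Y i \<omega>)\<bar>)", OF exp_rest]
      by (intro add_mono divide_right_mono sumZ_le) auto
    also have "\<dots> = (real (2 * K))\<^sup>2 / \<epsilon> / real n + 3 * \<epsilon>"
      using n \<epsilon> by (simp add: field_simps power2_eq_square)
    finally show ?thesis .
  qed
  have "(\<lambda>n. (real (2 * K))\<^sup>2 / \<epsilon> / real n) \<longlonglongrightarrow> 0"
    by (rule tendsto_divide_0[OF tendsto_const]) (rule filterlim_at_top_imp_at_infinity[OF filterlim_real_sequentially])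
  then have "\<forall>\<^sub>F n in sequentially. (real (2 * K))\<^sup>2 / \<epsilon> / real n < \<epsilon>"
    by (rule order_tendstoD) (rule \<epsilon>)
  then show "\<forall>\<^sub>F n in sequentially. dist (expectation (\<lambda>\<omega>. \<bar>(\<Sum>i<n. Y i \<omega>) / real n - (LINT y|N. y)\<bar>)) 0 < e"
    using eventually_gt_at_top[of 0]
  proof eventually_elim
    case (elim n)
    have "0 \<le> expectation (\<lambda>\<omega>. \<bar>(\<Sum>i<n. Y i \<omega>) / real n - c\<bar>)"
      by (rule integral_nonneg_AE) auto
    moreover have "expectation (\<lambda>\<omega>. \<bar>(\<Sum>i<n. Y i \<omega>) / real n - c\<bar>) < 4 * \<epsilon>"
      using bound[of n] elim by linarith
    ultimately show ?case
      using e by (simp add: c_def[symmetric] \<epsilon>_def)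
  qed
qed

text \<open>Leaving S forces the average at least e away from the mean, hence the sum of the
  absolute coordinate deviations is at least e; Markov's inequality and the scalar law finish. The
  form with an open set serves both the well-defined samples and the neighbourhoods in which an
  expansion holds.\<close>

lemma (in prob_space) lln_in_probability:
  fixes Y :: "nat \<Rightarrow> 'a \<Rightarrow> 'b::euclidean_space"
  assumes indep: "indep_vars (\<lambda>_. borel) Y UNIV"
    and distr: "\<And>i. distr M borel (Y i) = N"
    and int: "integrable N (\<lambda>y. y)"
    and S: "open S" "(LINT y|N. y) \<in> S"
  shows "(\<lambda>n. prob {\<omega> \<in> space M. (\<Sum>i<n. Y i \<omega>) /\<^sub>R real n \<in> S}) \<longlonglongrightarrow> 1"
proof -
  have Y[measurable]: "random_variable borel (Y i)" for i
    using indep by (simp add: indep_vars_def)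
  have [measurable]: "S \<in> sets borel" using S by simp
  have sets_N[measurable_cong]: "sets N = sets borel"
    using distr[of 0] by auto
  have intY: "integrable M (Y i)" for i
    using int unfolding distr[of i, symmetric] by (simp add: integrable_distr_eq)
  define c where "c = (LINT y|N. y)"
  obtain e where e: "0 < e" "ball c e \<subseteq> S"
    using S open_contains_ball unfolding c_def by blast
  define m where "m n \<omega> = (\<Sum>i<n. Y i \<omega>) /\<^sub>R real n" for n \<omega>
  have m[measurable]: "random_variable borel (m n)" for n
    unfolding m_def by measurable
  have int_m: "integrable M (m n)" for n
    unfolding m_def by (intro integrable_scaleR_right Bochner_Integration.integrable_sum intY)
  have comp: "(\<lambda>n. expectation (\<lambda>\<omega>. \<bar>(m n \<omega> - c) \<bullet> b\<bar>)) \<longlonglongrightarrow> 0" for b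
  proof -
    define N' where "N' = distr N borel (\<lambda>y. y \<bullet> b)"
    have "(\<lambda>n. expectation (\<lambda>\<omega>. \<bar>(\<Sum>i<n. Y i \<omega> \<bullet> b) / real n - (LINT y|N'. y)\<bar>)) \<longlonglongrightarrow> 0"
    proof (rule lln_L1_real)
      show "indep_vars (\<lambda>_. borel) (\<lambda>i \<omega>. Y i \<omega> \<bullet> b) UNIV"
        by (rule indep_vars_compose2[OF indep, where Y = "\<lambda>_ y. y \<bullet> b"]) measurable
      show "distr M borel (\<lambda>\<omega>. Y i \<omega> \<bullet> b) = N'" for i
        unfolding N'_def distr[of i, symmetric] by (simp add: distr_distr comp_def)
      show "integrable N' (\<lambda>y. y)"
        unfolding N'_def by (subst integrable_distr_eq) (auto intro: integrable_inner_left int)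
    qed
    moreover have "(LINT y|N'. y) = c \<bullet> b"
      unfolding N'_def c_def
      by (subst integral_distr) (auto intro: integral_inner_left int)
    ultimately show ?thesis
      by (simp add: m_def inner_diff_left inner_sum_left divide_inverse mult.commute)
  qed
  have "(\<lambda>n. \<Sum>b\<in>Basis. expectation (\<lambda>\<omega>. \<bar>(m n \<omega> - c) \<bullet> b\<bar>)) \<longlonglongrightarrow> (\<Sum>b\<in>(Basis::'b set). 0)"
    by (intro tendsto_sum comp)
  then have "(\<lambda>n. (\<Sum>b\<in>Basis. expectation (\<lambda>\<omega>. \<bar>(m n \<omega> - c) \<bullet> b\<bar>)) / e) \<longlonglongrightarrow> 0"
    by (auto intro: tendsto_divide_zero)
  then have lim: "(\<lambda>n. 1 - (\<Sum>b\<in>Basis. expectation (\<lambda>\<omega>. \<bar>(m n \<omega> - c) \<bullet> b\<bar>)) / e) \<longlonglongrightarrow> 1"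
    using tendsto_diff[OF tendsto_const, of _ 0 _ 1] by fastforce
  have lower: "1 - (\<Sum>b\<in>Basis. expectation (\<lambda>\<omega>. \<bar>(m n \<omega> - c) \<bullet> b\<bar>)) / e \<le>
      prob {\<omega> \<in> space M. m n \<omega> \<in> S}" for n
  proof -
    have int_b: "integrable M (\<lambda>\<omega>. \<bar>(m n \<omega> - c) \<bullet> b\<bar>)" for b
      using int_m by simp
    have "1 - prob {\<omega> \<in> space M. m n \<omega> \<in> S} = prob {\<omega> \<in> space M. m n \<omega> \<notin> S}"
      using prob_neg[of "\<lambda>\<omega>. m n \<omega> \<in> S"] by simp
    also have "\<dots> \<le> prob {\<omega> \<in> space M. e \<le> (\<Sum>b\<in>Basis. \<bar>(m n \<omega> - c) \<bullet> b\<bar>)}"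
    proof (rule finite_measure_mono)
      have "e \<le> (\<Sum>b\<in>Basis. \<bar>(m n \<omega> - c) \<bullet> b\<bar>)" if "m n \<omega> \<notin> S" for \<omega>
      proof -
        have "m n \<omega> \<notin> ball c e"
          using that e(2) by blast
        then have "e \<le> norm (m n \<omega> - c)"
          by (simp add: dist_norm norm_minus_commute)
        also have "\<dots> \<le> (\<Sum>b\<in>Basis. \<bar>(m n \<omega> - c) \<bullet> b\<bar>)"
          by (rule norm_le_l1)
        finally show ?thesis .
      qed
      then show "{\<omega> \<in> space M. m n \<omega> \<notin> S} \<subseteq> {\<omega> \<in> space M. e \<le> (\<Sum>b\<in>Basis. \<bar>(m n \<omega> - c) \<bullet> b\<bar>)}"
        by blast
    qed simp
    also have "\<dots> \<le> expectation (\<lambda>\<omega>. \<Sum>b\<in>Basis. \<bar>(m n \<omega> - c) \<bullet> b\<bar>) / e"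
      using e(1) by (intro integral_Markov_inequality_measure[where A = "{}"])
        (auto intro!: sum_nonneg Bochner_Integration.integrable_sum int_b)
    also have "\<dots> = (\<Sum>b\<in>Basis. expectation (\<lambda>\<omega>. \<bar>(m n \<omega> - c) \<bullet> b\<bar>)) / e"
      by (simp add: int_b)
    finally show ?thesis by simp
  qed
  show ?thesis
    unfolding m_def[symmetric]
    by (rule tendsto_sandwich[OF always_eventually always_eventually lim tendsto_const])
      (use lower in auto)
qed

section \<open>Convergence to the chi-square distribution\<close>

text \<open>Continuity makes the set of t with p \<le> cdf closed, so it contains its infimum; to
  the left of the infimum the cdf is below p, and left continuity rules out a jump past p.\<close>

lemma cdf_quantile:
  assumes M: "real_distribution M" and cont: "\<And>x. isCont (cdf M) x" and p: "0 < p" "p < 1"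
  shows "cdf M (quantile M p) = p"
proof -
  interpret real_distribution M by (rule M)
  define S where "S = {t. p \<le> cdf M t}"
  have "\<forall>\<^sub>F t in at_top. p < cdf M t"
    using cdf_lim_at_top_prob p(2) by (rule order_tendstoD)
  then obtain t where "p < cdf M t"
    using eventually_happens by fastforce
  then have ne: "S \<noteq> {}" by (auto simp: S_def intro: less_imp_le)
  have "\<forall>\<^sub>F t in at_bot. cdf M t < p"
    using cdf_lim_at_bot p(1) by (rule order_tendstoD)
  then obtain a where a: "cdf M a < p"
    using eventually_happens by fastforce
  have bdd: "bdd_below S"
  proof
    fix t assume "t \<in> S"
    then show "a \<le> t"
      using a cdf_nondecreasing[of t a] by (force simp: S_def)
  qed
  have "closed S"
    unfolding S_def using cont
    by (intro closed_Collect_le continuous_on_const continuous_at_imp_continuous_on) auto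
  from closed_contains_Inf[OF ne bdd this] have "p \<le> cdf M (Inf S)"
    by (simp add: S_def)
  moreover have "cdf M (Inf S) \<le> p"
  proof (rule tendsto_upperbound)
    show "(cdf M \<longlongrightarrow> cdf M (Inf S)) (at_left (Inf S))"
      using cont[of "Inf S"] by (simp add: continuous_within isCont_def filterlim_at_split)
    have "cdf M t \<le> p" if "t < Inf S" for t
      using cInf_lower[OF _ bdd, of t] that by (force simp: S_def)
    then show "\<forall>\<^sub>F t in at_left (Inf S). cdf M t \<le> p"
      by (auto simp: eventually_at_filter intro!: always_eventually)
  qed simp
  ultimately show ?thesis
    by (simp add: quantile_def S_def)
qed

text \<open>Under \<open>x \<mapsto> exp (- x)\<close> the Laplace transforms at the integers become moments of
  distributions on \<open>[0, 1]\<close>, so Weierstrass' theorem applies.\<close>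
lemma laplace_conv_imp_weak_conv:
  fixes Mn :: "nat \<Rightarrow> real measure" and N :: "real measure"
  assumes Mn: "\<And>n. real_distribution (Mn n)" "\<And>n. AE x in Mn n. 0 \<le> x"
    and N: "real_distribution N" "AE x in N. 0 \<le> x"
    and conv: "\<And>k::nat. (\<lambda>n. LINT x|Mn n. exp (- real k * x)) \<longlonglongrightarrow> (LINT x|N. exp (- real k * x))"
  shows "weak_conv_m Mn N"
proof (rule integral_cts_step_conv_imp_weak_conv[OF Mn(1) N(1)])
  fix x y :: real assume xy: "x < y"
  \<comment> \<open>The maximum with \<open>exp (- y)\<close> removes the singularity of the
    logarithm at 0. It costs nothing, since \<open>cts_step x y\<close> is 0 from y onwards.\<close>
  define f where "f u = cts_step x y (- ln (max u (exp (- y))))" for u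
  have f_eq: "cts_step x y q = f (exp (- q))" for q
    using xy by (cases "q \<le> y") (auto simp: f_def max_def cts_step_def)
  have "continuous_on UNIV (cts_step x y)"
    using cts_step_uniformly_continuous[OF xy] by (rule uniformly_continuous_imp_continuous)
  then have cont_f: "continuous_on {0..1} f"
    unfolding f_def
  proof (rule continuous_on_compose2)
    show "continuous_on {0..1} (\<lambda>u. - ln (max u (exp (- y))))"
      by (intro continuous_intros) (auto simp: max_def not_le intro: less_le_trans[OF exp_gt_zero] dest: less_imp_neq)
  qed simp
  \<comment> \<open>Concentration on the nonnegative reals puts \<open>exp (- q)\<close> almost
    surely into [0, 1], where the polynomial approximates; the error bound \<epsilon> therefore
    holds for all the measures simultaneously.\<close>
  have int_exp: "integrable L (\<lambda>q. exp (- real k * q))"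
    and close: "\<bar>integral\<^sup>L L (cts_step x y) - (LINT q|L. (\<Sum>k\<le>m. a k * exp (- real k * q)))\<bar> \<le> \<epsilon>"
      if L: "real_distribution L" "AE x in L. 0 \<le> x"
      and a: "\<And>u. u \<in> {0..1} \<Longrightarrow> \<bar>f u - (\<Sum>k\<le>m. a k * u ^ k)\<bar> \<le> \<epsilon>"
    for L k a m \<epsilon>
  proof -
    interpret L: real_distribution L by (rule L(1))
    have int: "integrable L (\<lambda>q. exp (- real k * q))" for k
      using L(2) by (intro L.integrable_const_bound[of _ 1]) auto
    then show "integrable L (\<lambda>q. exp (- real k * q))" .
    have int_step: "integrable L (cts_step x y)"
      using xy by (rule L.integrable_cts_step)
    have int_sum: "integrable L (\<lambda>q. \<Sum>k\<le>m. a k * exp (- real k * q))"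
      by (intro Bochner_Integration.integrable_sum integrable_mult_right int)
    have "\<bar>integral\<^sup>L L (cts_step x y) - (LINT q|L. (\<Sum>k\<le>m. a k * exp (- real k * q)))\<bar> =
      \<bar>LINT q|L. cts_step x y q - (\<Sum>k\<le>m. a k * exp (- real k * q))\<bar>"
      by (subst Bochner_Integration.integral_diff[OF int_step int_sum]) simp
    also have "\<dots> \<le> (LINT q|L. \<bar>cts_step x y q - (\<Sum>k\<le>m. a k * exp (- real k * q))\<bar>)"
      by (rule integral_abs_bound)
    also have "\<dots> \<le> (LINT q|L. \<epsilon>)"
    proof (rule integral_mono_AE)
      show "AE q in L. \<bar>cts_step x y q - (\<Sum>k\<le>m. a k * exp (- real k * q))\<bar> \<le> \<epsilon>"
        using L(2)
      proof eventually_elim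
        case (elim q)
        then show ?case
          using a[of "exp (- q)"] by (simp add: f_eq exp_of_nat_mult[symmetric])
      qed
    qed (use int_step int_sum in auto)
    finally show "\<bar>integral\<^sup>L L (cts_step x y) - (LINT q|L. (\<Sum>k\<le>m. a k * exp (- real k * q)))\<bar> \<le> \<epsilon>"
      using L.prob_space by simp
  qed
  show "(\<lambda>n. integral\<^sup>L (Mn n) (cts_step x y)) \<longlonglongrightarrow> integral\<^sup>L N (cts_step x y)"
  proof (rule tendstoI)
    fix e :: real assume e: "0 < e"
    obtain g where g: "real_polynomial_function g" "\<And>u. u \<in> {0..1} \<Longrightarrow> \<bar>f u - g u\<bar> < e / 3"
      using Stone_Weierstrass_real_polynomial_function[OF _ cont_f, of "e / 3"] e by auto
    then obtain a m where am: "g = (\<lambda>u. \<Sum>k\<le>m. a k * u ^ k)"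
      unfolding real_polynomial_function_iff_sum by blast
    have a: "\<bar>f u - (\<Sum>k\<le>m. a k * u ^ k)\<bar> \<le> e / 3" if "u \<in> {0..1}" for u
      using g(2)[OF that] by (simp add: am)
    define I where "I L = (LINT q|L. (\<Sum>k\<le>m. a k * exp (- real k * q)))" for L
    have I: "I L = (\<Sum>k\<le>m. a k * (LINT q|L. exp (- real k * q)))"
      if "real_distribution L" "AE x in L. 0 \<le> x" for L
    proof -
      have "integrable L (\<lambda>q. a k * exp (- real k * q))" for k
        by (rule integrable_mult_right[OF int_exp[OF that a]])
      then show ?thesis
        unfolding I_def by (subst Bochner_Integration.integral_sum) auto
    qed
    have "(\<lambda>n. I (Mn n)) \<longlonglongrightarrow> I N"
      unfolding I[OF Mn] I[OF N] by (intro tendsto_intros conv)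
    then have "\<forall>\<^sub>F n in sequentially. dist (I (Mn n)) (I N) < e / 3"
      using e by (intro tendstoD) auto
    then show "\<forall>\<^sub>F n in sequentially. dist (integral\<^sup>L (Mn n) (cts_step x y)) (integral\<^sup>L N (cts_step x y)) < e"
    proof eventually_elim
      case (elim n)
      then show ?case
        using close[OF Mn a, of n] close[OF N a]
        unfolding I_def[symmetric] dist_real_def by linarith
    qed
  qed
qed

section \<open>The chi-square distribution\<close>

lemma real_distribution_chi_square: "real_distribution (chi_square d)"
  unfolding chi_square_def
proof (rule prob_space.real_distribution_distr)
  show "prob_space (Pi\<^sub>M {..<d} (\<lambda>_. std_normal_distribution))"
    by (intro prob_space_PiM prob_space_normal_density) simp
qed measurable

lemma AE_chi_square_nonneg: "AE x in chi_square d. 0 \<le> x"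
  unfolding chi_square_def by (subst AE_distr_iff) (auto intro!: sum_nonneg)

lemma integral_chi_square:
  fixes f :: "real \<Rightarrow> 'b::{banach, second_countable_topology}"
  assumes "f \<in> borel_measurable borel"
  shows "(LINT x|chi_square d. f x) =
    (LINT z|Pi\<^sub>M {..<d} (\<lambda>_. std_normal_distribution). f (\<Sum>i<d. (z i)\<^sup>2))"
  unfolding chi_square_def using assms by (subst integral_distr) auto

text \<open>There are no atoms: with the other coordinates fixed, the last one must solve y^2 = c,
  which leaves at most two points, a null set for the normal density. For d = 0 that coordinate is
  missing and the law is a point mass at 0.\<close>

lemma isCont_cdf_chi_square:
  assumes "0 < d"
  shows "isCont (cdf (chi_square d)) t"
proof -
  interpret C: real_distribution "chi_square d" by (rule real_distribution_chi_square)
  obtain m where m: "d = Suc m" using assms gr0_implies_Suc by blast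
  interpret product_sigma_finite "\<lambda>_::nat. std_normal_distribution"
    by (intro product_sigma_finite.intro prob_space_imp_sigma_finite prob_space_normal_density) simp
  define \<Gamma> where "\<Gamma> n = Pi\<^sub>M {..<n} (\<lambda>_. std_normal_distribution)" for n :: nat
  have "emeasure (chi_square d) {t} = emeasure (\<Gamma> d) {z \<in> space (\<Gamma> d). (\<Sum>i<d. (z i)\<^sup>2) = t}"
    unfolding chi_square_def \<Gamma>_def by (subst emeasure_distr) (auto intro!: arg_cong2[where f = emeasure])
  also have "\<dots> = (\<integral>\<^sup>+z. indicator {z \<in> space (\<Gamma> d). (\<Sum>i<d. (z i)\<^sup>2) = t} z \<partial>\<Gamma> d)"
    unfolding \<Gamma>_def by (subst nn_integral_indicator) auto
  also have "\<dots> = (\<integral>\<^sup>+z. indicator {t} (\<Sum>i<d. (z i)\<^sup>2) \<partial>\<Gamma> d)"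
    by (intro nn_integral_cong) (auto split: split_indicator)
  also have "\<dots> = (\<integral>\<^sup>+z. (\<integral>\<^sup>+y. indicator {t} (\<Sum>i<d. ((z(m := y)) i)\<^sup>2) \<partial>std_normal_distribution) \<partial>\<Gamma> m)"
    unfolding \<Gamma>_def m lessThan_Suc by (subst product_nn_integral_insert) auto
  also have "\<dots> = (\<integral>\<^sup>+z. 0 \<partial>\<Gamma> m)"
  proof (rule nn_integral_cong)
    fix z :: "nat \<Rightarrow> real"
    define c where "c = t - (\<Sum>i<m. (z i)\<^sup>2)"
    have "(\<Sum>i<d. ((z(m := y)) i)\<^sup>2) = t \<longleftrightarrow> y\<^sup>2 = c" for y
      by (auto simp: m c_def)
    then have "(\<integral>\<^sup>+y. indicator {t} (\<Sum>i<d. ((z(m := y)) i)\<^sup>2) \<partial>std_normal_distribution) =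
      (\<integral>\<^sup>+y. indicator {y. y\<^sup>2 = c} y \<partial>std_normal_distribution)"
      by (intro nn_integral_cong) (auto split: split_indicator)
    also have "\<dots> = (\<integral>\<^sup>+y\<in>{y. y\<^sup>2 = c}. ennreal (std_normal_density y) \<partial>lborel)"
      by (subst nn_integral_density) auto
    also have "\<dots> = 0"
    proof (rule nn_integral_null_set)
      have "{y. y\<^sup>2 = c} \<subseteq> {sqrt c, - sqrt c}"
        by (auto simp: real_sqrt_abs abs_if)
      then have "finite {y. y\<^sup>2 = c}"
        by (rule finite_subset) simp
      then show "{y. y\<^sup>2 = c} \<in> null_sets lborel"
        by (rule finite_imp_null_set_lborel)
    qed
    finally show "(\<integral>\<^sup>+y. indicator {t} (\<Sum>i<d. ((z(m := y)) i)\<^sup>2) \<partial>std_normal_distribution) = 0" .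
  qed
  finally show ?thesis
    by (simp add: C.isCont_cdf measure_def)
qed

text \<open>Cramer-Wold reduction: u \<bullet> Y i are scalars of variance u \<bullet> u. The scalar
  theorem divides by the standard deviation \<open>norm u\<close>, and evaluating the characteristic
  function at \<open>norm u\<close> undoes this. For u = 0 the variance degenerates, whence the
  separate case.\<close>

lemma (in prob_space) char_normalized_sum_conv:
  fixes Y :: "nat \<Rightarrow> 'a \<Rightarrow> 'b::euclidean_space"
  assumes indep: "indep_vars (\<lambda>_. borel) Y UNIV"
    and distr: "\<And>i. distr M borel (Y i) = N"
    and sq: "integrable M (\<lambda>\<omega>. (u \<bullet> Y 0 \<omega>)\<^sup>2)"
    and mean: "expectation (\<lambda>\<omega>. u \<bullet> Y 0 \<omega>) = 0"
    and var: "expectation (\<lambda>\<omega>. (u \<bullet> Y 0 \<omega>)\<^sup>2) = u \<bullet> u"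
  shows "(\<lambda>n. LINT \<omega>|M. iexp (u \<bullet> ((\<Sum>i<n. Y i \<omega>) /\<^sub>R sqrt n))) \<longlonglongrightarrow> exp (- (u \<bullet> u) / 2)"
proof (cases "u = 0")
  case True
  then show ?thesis by (simp add: prob_space)
next
  case False
  have Y[measurable]: "random_variable borel (Y i)" for i
    using indep by (simp add: indep_vars_def)
  define Z where "Z i \<omega> = u \<bullet> Y i \<omega>" for i \<omega>
  have Z_distr: "distr M borel (Z i) = distr N borel ((\<bullet>) u)" for i
    unfolding distr[of i, symmetric] by (subst distr_distr) (auto simp: comp_def Z_def[abs_def])
  have Z_N: "integrable M (\<lambda>\<omega>. g (Z i \<omega>)) \<longleftrightarrow> integrable M (\<lambda>\<omega>. g (Z 0 \<omega>))"
    "expectation (\<lambda>\<omega>. g (Z i \<omega>)) = expectation (\<lambda>\<omega>. g (Z 0 \<omega>))"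
    if "g \<in> borel_measurable borel" for g :: "real \<Rightarrow> real" and i
  proof -
    have [measurable]: "random_variable borel (Z i)" for i
      unfolding Z_def by measurable
    have "integrable M (\<lambda>\<omega>. g (Z i \<omega>)) \<longleftrightarrow> integrable (distr N borel ((\<bullet>) u)) g"
      "expectation (\<lambda>\<omega>. g (Z i \<omega>)) = integral\<^sup>L (distr N borel ((\<bullet>) u)) g" for i
      using that unfolding Z_distr[of i, symmetric] by (simp_all add: integrable_distr_eq integral_distr)
    then show "integrable M (\<lambda>\<omega>. g (Z i \<omega>)) \<longleftrightarrow> integrable M (\<lambda>\<omega>. g (Z 0 \<omega>))"
      "expectation (\<lambda>\<omega>. g (Z i \<omega>)) = expectation (\<lambda>\<omega>. g (Z 0 \<omega>))"
      by metis+
  qed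
  have Z_mean: "expectation (Z i) = 0" for i
    using Z_N(2)[of "\<lambda>x. x" i] mean by (simp add: Z_def[abs_def])
  have W: "weak_conv_m (\<lambda>n. distr M borel (\<lambda>\<omega>. (\<Sum>i<n. Z i \<omega>) / sqrt (n * (norm u)\<^sup>2))) std_normal_distribution"
  proof (rule central_limit_theorem_zero_mean)
    show "indep_vars (\<lambda>_. borel) Z UNIV"
      unfolding Z_def by (rule indep_vars_compose2[OF indep, where Y = "\<lambda>_. (\<bullet>) u"]) measurable
    show "integrable M (\<lambda>\<omega>. (Z i \<omega>)\<^sup>2)" for i
      using Z_N(1)[of "\<lambda>x. x\<^sup>2" i] sq by (simp add: Z_def)
    show "variance (Z i) = (norm u)\<^sup>2" for i
      using Z_N(2)[of "\<lambda>x. x\<^sup>2" i] var unfolding Z_mean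
      by (simp add: Z_def power2_norm_eq_inner)
  qed (use False Z_mean Z_distr in auto)
  have m[measurable]: "random_variable borel (\<lambda>\<omega>. (\<Sum>i<n. Z i \<omega>) / sqrt (n * (norm u)\<^sup>2))" for n
    unfolding Z_def by measurable
  have "(\<lambda>n. char (distr M borel (\<lambda>\<omega>. (\<Sum>i<n. Z i \<omega>) / sqrt (n * (norm u)\<^sup>2))) (norm u)) \<longlonglongrightarrow>
      char std_normal_distribution (norm u)"
    by (rule levy_continuity1[OF _ real_dist_normal_dist W]) (rule real_distribution_distr[OF m])
  moreover have "char (distr M borel (\<lambda>\<omega>. (\<Sum>i<n. Z i \<omega>) / sqrt (n * (norm u)\<^sup>2))) (norm u) =
      (LINT \<omega>|M. iexp (u \<bullet> ((\<Sum>i<n. Y i \<omega>) /\<^sub>R sqrt n)))" for n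
  proof -
    have "norm u * ((\<Sum>i<n. Z i \<omega>) / sqrt (n * (norm u)\<^sup>2)) = u \<bullet> ((\<Sum>i<n. Y i \<omega>) /\<^sub>R sqrt n)" for \<omega>
      using False by (simp add: Z_def real_sqrt_mult inner_sum_right divide_inverse mult.commute)
    then show ?thesis
      unfolding char_def by (subst integral_distr) auto
  qed
  moreover have "char std_normal_distribution (norm u) = complex_of_real (exp (- (u \<bullet> u) / 2))"
    by (simp add: char_std_normal_distribution power2_norm_eq_inner)
  ultimately show ?thesis by simp
qed

text \<open>\<open>exp (- k |x|\<^sup>2)\<close> is the expectation of \<open>exp (\<i> \<surd>(2k) x \<bullet> z)\<close> over a standard Gaussian \<open>z\<close>,
  so that the one-dimensional central limit theorem yields the limit of the Laplace transform of
  the squared norm.\<close>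
theorem (in prob_space) weak_conv_chi_square:
  fixes Y :: "nat \<Rightarrow> 'a \<Rightarrow> real ^ 'd::finite"
  assumes indep: "indep_vars (\<lambda>_. borel) Y UNIV"
    and distr: "\<And>i. distr M borel (Y i) = N"
    and sq: "\<And>u. integrable M (\<lambda>\<omega>. (u \<bullet> Y 0 \<omega>)\<^sup>2)"
    and mean: "\<And>u. expectation (\<lambda>\<omega>. u \<bullet> Y 0 \<omega>) = 0"
    and var: "\<And>u. expectation (\<lambda>\<omega>. (u \<bullet> Y 0 \<omega>)\<^sup>2) = u \<bullet> u"
  shows "weak_conv_m (\<lambda>n. distr M borel (\<lambda>\<omega>. (norm ((\<Sum>i<n. Y i \<omega>) /\<^sub>R sqrt n))\<^sup>2)) (chi_square CARD('d))"
proof -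
  have Y[measurable]: "random_variable borel (Y i)" for i
    using indep by (simp add: indep_vars_def)
  define S where "S n \<omega> = (\<Sum>i<n. Y i \<omega>) /\<^sub>R sqrt n" for n \<omega>
  have S[measurable]: "random_variable borel (S n)" for n
    unfolding S_def by measurable
  have [measurable]: "random_variable borel (\<lambda>\<omega>. S n \<omega> $ a)" for n a
    by (rule measurable_compose[OF S borel_measurable_continuous_onI]) (intro continuous_intros)
  define \<Gamma> where "\<Gamma> = Pi\<^sub>M {..<CARD('d)} (\<lambda>_. std_normal_distribution)"
  interpret product_sigma_finite "\<lambda>_::nat. std_normal_distribution"
    by (intro product_sigma_finite.intro prob_space_imp_sigma_finite prob_space_normal_density) simp
  interpret \<Gamma>: prob_space \<Gamma>
    unfolding \<Gamma>_def by (intro prob_space_PiM prob_space_normal_density) simp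
  interpret G: real_distribution std_normal_distribution by (rule real_dist_normal_dist)
  interpret pair_sigma_finite M \<Gamma> ..
  interpret MG: pair_prob_space M \<Gamma> ..
  \<comment> \<open>The Gaussian coordinates in \<open>chi_square\<close> are indexed by natural
    numbers, those of the vectors by the type \<open>'d\<close>; b identifies the two index
    sets.\<close>
  obtain b where b: "bij_betw b {..<CARD('d)} (UNIV :: 'd set)"
    using ex_bij_betw_nat_finite[of "UNIV :: 'd set"] by (auto simp: atLeast0LessThan)
  define c where "c = inv_into {..<CARD('d)} b"
  have c: "c (b i) = i" if "i < CARD('d)" for i
    using that b by (simp add: c_def bij_betw_def)
  define vec where "vec z = (\<chi> a. z (c a))" for z :: "nat \<Rightarrow> real"
  have vec_inner: "vec z \<bullet> v = (\<Sum>i<CARD('d). z i * v $ b i)" for z v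
    unfolding inner_vec_def
    by (subst sum.reindex_bij_betw[OF b, symmetric]) (simp add: vec_def c)
  have vec_sq: "vec z \<bullet> vec z = (\<Sum>i<CARD('d). (z i)\<^sup>2)" for z
    unfolding vec_inner by (simp add: vec_def c power2_eq_square)
  have norm_sq: "(norm v)\<^sup>2 = (\<Sum>i<CARD('d). (v $ b i)\<^sup>2)" for v :: "real ^ 'd"
    unfolding power2_norm_eq_inner inner_vec_def
    by (subst sum.reindex_bij_betw[OF b, symmetric]) (simp add: power2_eq_square)
  show ?thesis
    unfolding S_def[symmetric]
  proof (rule laplace_conv_imp_weak_conv)
    show "real_distribution (distr M borel (\<lambda>\<omega>. (norm (S n \<omega>))\<^sup>2))" for n
      by (rule real_distribution_distr) simp
    show "AE x in distr M borel (\<lambda>\<omega>. (norm (S n \<omega>))\<^sup>2). 0 \<le> x" for n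
      by (subst AE_distr_iff) auto
    fix k :: nat
    define s where "s = sqrt (2 * k)"
    have s: "s\<^sup>2 = 2 * k" by (simp add: s_def)
    have gauss: "complex_of_real (exp (- k * (norm v)\<^sup>2)) = (LINT z|\<Gamma>. iexp (s *\<^sub>R vec z \<bullet> v))" for v
    proof -
      have int: "integrable std_normal_distribution (\<lambda>x. iexp (s * v $ b i * x))" for i
        by (rule G.integrable_const_bound[of _ 1]) auto
      have char_std: "complex_of_real (exp (- (t\<^sup>2) / 2)) = (LINT x|std_normal_distribution. iexp (t * x))" for t
        using fun_cong[OF char_std_normal_distribution, of t] unfolding char_def by simp
      have "complex_of_real (exp (- k * (norm v)\<^sup>2)) =
          (\<Prod>i<CARD('d). complex_of_real (exp (- ((s * v $ b i)\<^sup>2) / 2)))"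
        by (simp add: norm_sq sum_distrib_left exp_sum[symmetric] power_mult_distrib s flip: of_real_prod sum_negf)
      also have "\<dots> = (\<Prod>i<CARD('d). LINT x|std_normal_distribution. iexp (s * v $ b i * x))"
        by (intro prod.cong refl char_std)
      also have "\<dots> = (LINT z|\<Gamma>. (\<Prod>i<CARD('d). iexp (s * v $ b i * z i)))"
        unfolding \<Gamma>_def by (rule product_integral_prod[symmetric]) (use int in auto)
      also have "\<dots> = (LINT z|\<Gamma>. iexp (s *\<^sub>R vec z \<bullet> v))"
        by (simp add: vec_inner sum_distrib_left exp_sum[symmetric] ac_simps)
      finally show ?thesis .
    qed
    have meas: "(\<lambda>(\<omega>, z). iexp (s *\<^sub>R vec z \<bullet> S n \<omega>)) \<in> borel_measurable (M \<Otimes>\<^sub>M \<Gamma>)" for n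
      unfolding inner_scaleR_left vec_inner \<Gamma>_def by measurable
    \<comment> \<open>After the exchange z is fixed in the inner integral, which is the
      characteristic function of S n at s times \<open>vec z\<close>. The limit theorem applies for
      each z, and the constant 1 dominates the outer integral.\<close>
    have fubini: "complex_of_real (LINT x|distr M borel (\<lambda>\<omega>. (norm (S n \<omega>))\<^sup>2). exp (- real k * x)) =
        (LINT z|\<Gamma>. LINT \<omega>|M. iexp (s *\<^sub>R vec z \<bullet> S n \<omega>))" for n
    proof -
      have "integrable (M \<Otimes>\<^sub>M \<Gamma>) (\<lambda>(\<omega>, z). iexp (s *\<^sub>R vec z \<bullet> S n \<omega>))"
        by (rule MG.P.integrable_const_bound[of _ 1, OF _ meas]) auto
      from Fubini_integral[OF this] show ?thesis
        unfolding gauss[symmetric] by (simp add: integral_distr)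
    qed
    \<comment> \<open>The relation s^2 = 2k is used a second time, now on the squared norm of the
      Gaussian vector itself, which has the chi-square law.\<close>
    have limit: "(LINT z|\<Gamma>. complex_of_real (exp (- (s *\<^sub>R vec z \<bullet> s *\<^sub>R vec z) / 2))) =
        complex_of_real (LINT x|chi_square CARD('d). exp (- real k * x))"
    proof -
      have "s *\<^sub>R vec z \<bullet> s *\<^sub>R vec z = s\<^sup>2 * (vec z \<bullet> vec z)" for z
        by (simp add: power2_eq_square)
      then have "s *\<^sub>R vec z \<bullet> s *\<^sub>R vec z / 2 = real k * (\<Sum>i<CARD('d). (z i)\<^sup>2)" for z
        by (simp add: s vec_sq del: inner_scaleR_left inner_scaleR_right)
      then show ?thesis
        by (simp add: integral_chi_square \<Gamma>_def del: inner_scaleR_left inner_scaleR_right)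
    qed
    have "(\<lambda>n. LINT z|\<Gamma>. LINT \<omega>|M. iexp (s *\<^sub>R vec z \<bullet> S n \<omega>)) \<longlonglongrightarrow>
        (LINT z|\<Gamma>. complex_of_real (exp (- (s *\<^sub>R vec z \<bullet> s *\<^sub>R vec z) / 2)))"
    proof (rule integral_dominated_convergence[where w = "\<lambda>_. 1"])
      show "(\<lambda>z. complex_of_real (exp (- (s *\<^sub>R vec z \<bullet> s *\<^sub>R vec z) / 2))) \<in> borel_measurable \<Gamma>"
        unfolding inner_scaleR_left inner_scaleR_right vec_sq \<Gamma>_def by measurable
      show "(\<lambda>z. LINT \<omega>|M. iexp (s *\<^sub>R vec z \<bullet> S n \<omega>)) \<in> borel_measurable \<Gamma>" for n
        using meas[of n] by measurable
      show "AE z in \<Gamma>. (\<lambda>n. LINT \<omega>|M. iexp (s *\<^sub>R vec z \<bullet> S n \<omega>)) \<longlonglongrightarrow>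
          complex_of_real (exp (- (s *\<^sub>R vec z \<bullet> s *\<^sub>R vec z) / 2))"
        unfolding S_def by (intro AE_I2 char_normalized_sum_conv[OF indep distr sq mean var])
      show "AE z in \<Gamma>. norm (LINT \<omega>|M. iexp (s *\<^sub>R vec z \<bullet> S n \<omega>)) \<le> 1" for n
      proof (rule AE_I2)
        fix z
        have "norm (LINT \<omega>|M. iexp (s *\<^sub>R vec z \<bullet> S n \<omega>)) \<le> (LINT \<omega>|M. norm (iexp (s *\<^sub>R vec z \<bullet> S n \<omega>)))"
          by (rule integral_norm_bound)
        then show "norm (LINT \<omega>|M. iexp (s *\<^sub>R vec z \<bullet> S n \<omega>)) \<le> 1"
          by (simp add: prob_space)
      qed
    qed simp
    then have "(\<lambda>n. complex_of_real (LINT x|distr M borel (\<lambda>\<omega>. (norm (S n \<omega>))\<^sup>2). exp (- real k * x))) \<longlonglongrightarrow>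
        complex_of_real (LINT x|chi_square CARD('d). exp (- real k * x))"
      by (simp only: fubini limit)
    then show "(\<lambda>n. LINT x|distr M borel (\<lambda>\<omega>. (norm (S n \<omega>))\<^sup>2). exp (- real k * x)) \<longlonglongrightarrow>
        (LINT x|chi_square CARD('d). exp (- real k * x))"
      by (simp only: tendsto_of_real_iff)
  qed (rule real_distribution_chi_square AE_chi_square_nonneg)+
qed

section \<open>Quadratic delta method\<close>

text \<open>With w = L \<delta> and r = t - w the difference of the forms splits into t \<bullet> (H
  - H0) t + r \<bullet> H0 t + w \<bullet> H0 r: each term has one small factor and two of order
  \<delta>. The displacement is kept apart from the argument of \<open>H\<close>, since in the
  application \<open>H\<close> depends on both components of z while the error is measured by the
  first.\<close>

lemma quadratic_form_expansion:
  fixes L :: "'a::real_normed_vector \<Rightarrow> real ^ 'd" and H :: "'z \<Rightarrow> real ^ 'd ^ 'd"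
  assumes L: "bounded_linear L" and H: "(H \<longlongrightarrow> H0) F"
    and t: "\<And>\<epsilon>. 0 < \<epsilon> \<Longrightarrow> \<forall>\<^sub>F z in F. norm (t z - L (\<delta> z)) \<le> \<epsilon> * norm (\<delta> z)"
    and \<epsilon>: "0 < \<epsilon>"
  shows "\<forall>\<^sub>F z in F. \<bar>t z \<bullet> (H z *v t z) - L (\<delta> z) \<bullet> (H0 *v L (\<delta> z))\<bar> \<le> \<epsilon> * (norm (\<delta> z))\<^sup>2"
proof -
  obtain C where C: "0 < C" "\<And>x. norm (L x) \<le> norm x * C"
    using bounded_linear.pos_bounded[OF L] by blast
  \<comment> \<open>\<open>K - 1\<close> adds up the coefficients contributed by the three terms of
    the splitting. Capping \<eta> at 1 gives the bound (C + 1) d for the norm of t z.\<close>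
  define K where "K = (C + 1)\<^sup>2 + 2 * (C + 1) * norm H0 + 1"
  have K: "0 < K"
    using C(1) by (auto simp: K_def intro!: add_nonneg_pos)
  define \<eta> where "\<eta> = min 1 (\<epsilon> / K)"
  have \<eta>: "0 < \<eta>" "\<eta> \<le> 1" "\<eta> * K \<le> \<epsilon>"
    using \<epsilon> K by (auto simp: \<eta>_def min_def field_simps)
  have "\<forall>\<^sub>F z in F. dist (H z) H0 < \<eta>"
    using H \<eta>(1) by (rule tendstoD)
  then show ?thesis
    using t[OF \<eta>(1)]
  proof eventually_elim
    case (elim z)
    define w where "w = L (\<delta> z)"
    define r where "r = t z - w"
    define d where "d = norm (\<delta> z)"
    have d: "0 \<le> d" by (simp add: d_def)
    have w: "norm w \<le> (C + 1) * d"
      using C(2)[of "\<delta> z"] d by (simp add: w_def algebra_simps flip: d_def)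
    have r: "norm r \<le> \<eta> * d"
      using elim(2) by (simp add: r_def w_def d_def)
    have "norm (t z) \<le> norm w + norm r"
      using norm_triangle_ineq[of w r] by (simp add: r_def)
    also have "\<dots> \<le> C * d + 1 * d"
      using C(2)[of "\<delta> z"] r mult_right_mono[OF \<eta>(2) d] by (simp add: w_def d_def mult.commute)
    finally have tz: "norm (t z) \<le> (C + 1) * d"
      by (simp add: algebra_simps)
    have H': "norm (H z - H0) \<le> \<eta>"
      using elim(1) by (simp add: dist_norm)
    have bil: "\<bar>x \<bullet> (A *v y)\<bar> \<le> a * b * c" if "norm x \<le> a" "norm A \<le> b" "norm y \<le> c" for x y :: "real ^ 'd" and A a b c
    proof -
      have "\<bar>x \<bullet> (A *v y)\<bar> \<le> norm x * (norm A * norm y)"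
        by (intro order_trans[OF Cauchy_Schwarz_ineq2] mult_left_mono norm_matrix_vector_mult_le) simp
      also have "\<dots> \<le> a * (b * c)"
        using that by (intro mult_mono) (auto intro: order_trans[OF norm_ge_zero])
      finally show ?thesis by (simp add: mult.assoc)
    qed
    have "t z \<bullet> (H z *v t z) - w \<bullet> (H0 *v w) =
        t z \<bullet> ((H z - H0) *v t z) + r \<bullet> (H0 *v t z) + w \<bullet> (H0 *v r)"
      by (simp add: r_def matrix_vector_mult_diff_rdistrib matrix_vector_mult_diff_distrib
          inner_diff_left inner_diff_right)
    also have "\<bar>\<dots>\<bar> \<le> ((C + 1) * d) * \<eta> * ((C + 1) * d) + (\<eta> * d) * norm H0 * ((C + 1) * d)
        + ((C + 1) * d) * norm H0 * (\<eta> * d)"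
      using bil[OF tz H' tz] bil[OF r order_refl[of "norm H0"] tz] bil[OF w order_refl[of "norm H0"] r] by linarith
    also have "\<dots> = \<eta> * (K - 1) * d\<^sup>2"
      by (simp add: K_def power2_eq_square algebra_simps)
    also have "\<dots> \<le> \<epsilon> * d\<^sup>2"
      using \<eta> by (intro mult_right_mono) (auto simp: algebra_simps)
    finally show ?case
      by (simp add: w_def d_def)
  qed
qed

text \<open>A Slutsky sandwich: outside a set of small probability the event lies between R \<le> q
  - \<eta> and R \<le> q + \<eta>, and continuity of the limiting cdf closes the gap. Measurability
  is asked of the event rather than of \<open>T\<close>, because the statistic has a meaning only on
  \<open>E\<close>, whose complement is absorbed by the exceptional sets.\<close>

lemma (in prob_space) prob_le_converges_cdf:
  fixes T R :: "nat \<Rightarrow> 'a \<Rightarrow> real"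
  assumes R: "\<And>n. random_variable borel (R n)" "weak_conv_m (\<lambda>n. distr M borel (R n)) L"
    and cont: "\<And>x. isCont (cdf L) x"
    and meas: "\<And>n. {\<omega> \<in> space M. \<omega> \<in> E n \<and> T n \<omega> \<le> q} \<in> events"
    and close: "\<And>\<eta> \<delta>. 0 < \<eta> \<Longrightarrow> 0 < \<delta> \<Longrightarrow> \<exists>B. (\<forall>n. B n \<in> events) \<and> (\<forall>\<^sub>F n in sequentially. prob (B n) \<le> \<delta>) \<and>
      (\<forall>n. \<forall>\<omega>\<in>space M - B n. \<omega> \<in> E n \<and> \<bar>T n \<omega> - R n \<omega>\<bar> \<le> \<eta>)"
  shows "(\<lambda>n. prob {\<omega> \<in> space M. \<omega> \<in> E n \<and> T n \<omega> \<le> q}) \<longlonglongrightarrow> cdf L q"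
proof (rule tendstoI)
  note R(1)[measurable]
  fix e :: real assume e: "0 < e"
  have "\<forall>\<^sub>F x in at q. dist (cdf L x) (cdf L q) < e / 3"
    using cont[of q] e by (intro tendstoD) (auto simp: isCont_def)
  then obtain d where d: "0 < d" "\<And>x. x \<noteq> q \<Longrightarrow> dist x q < d \<Longrightarrow> dist (cdf L x) (cdf L q) < e / 3"
    unfolding eventually_at by blast
  define \<eta> where "\<eta> = d / 2"
  have \<eta>: "0 < \<eta>" using d by (simp add: \<eta>_def)
  have upper: "\<bar>cdf L (q + \<eta>) - cdf L q\<bar> < e / 3" and lower: "\<bar>cdf L (q - \<eta>) - cdf L q\<bar> < e / 3"
    using d(2)[of "q + \<eta>"] d(2)[of "q - \<eta>"] d(1) by (auto simp: \<eta>_def dist_real_def)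
  obtain B where B: "\<And>n. B n \<in> events" "\<forall>\<^sub>F n in sequentially. prob (B n) \<le> e / 3"
    "\<And>n \<omega>. \<omega> \<in> space M \<Longrightarrow> \<omega> \<notin> B n \<Longrightarrow> \<omega> \<in> E n \<and> \<bar>T n \<omega> - R n \<omega>\<bar> \<le> \<eta>"
    using close[OF \<eta>, of "e / 3"] e by auto
  have cdf_R: "cdf (distr M borel (R n)) x = prob {\<omega> \<in> space M. R n \<omega> \<le> x}" for n x
    unfolding cdf_def by (subst measure_distr) (auto intro!: arg_cong[where f = prob])
  have conv: "(\<lambda>n. prob {\<omega> \<in> space M. R n \<omega> \<le> x}) \<longlonglongrightarrow> cdf L x" for x
    using R(2) cont[of x] by (simp add: weak_conv_m_def weak_conv_def cdf_R)
  have "\<forall>\<^sub>F n in sequentially. dist (prob {\<omega> \<in> space M. R n \<omega> \<le> q + \<eta>}) (cdf L (q + \<eta>)) < e / 3"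
    "\<forall>\<^sub>F n in sequentially. dist (prob {\<omega> \<in> space M. R n \<omega> \<le> q - \<eta>}) (cdf L (q - \<eta>)) < e / 3"
    by (rule tendstoD[OF conv], simp add: e)+
  with B(2) show "\<forall>\<^sub>F n in sequentially. dist (prob {\<omega> \<in> space M. \<omega> \<in> E n \<and> T n \<omega> \<le> q}) (cdf L q) < e"
  proof eventually_elim
    case (elim n)
    define A where "A = {\<omega> \<in> space M. \<omega> \<in> E n \<and> T n \<omega> \<le> q}"
    have "prob A \<le> prob ({\<omega> \<in> space M. R n \<omega> \<le> q + \<eta>} \<union> B n)"
    proof (rule finite_measure_mono)
      show "A \<subseteq> {\<omega> \<in> space M. R n \<omega> \<le> q + \<eta>} \<union> B n"
        using B(3)[of _ n] by (fastforce simp: A_def)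
    qed (use B(1) in measurable)
    also have "\<dots> \<le> prob {\<omega> \<in> space M. R n \<omega> \<le> q + \<eta>} + prob (B n)"
      using B(1) by (intro measure_Un_le) auto
    finally have 1: "prob A \<le> prob {\<omega> \<in> space M. R n \<omega> \<le> q + \<eta>} + prob (B n)" .
    have "prob {\<omega> \<in> space M. R n \<omega> \<le> q - \<eta>} \<le> prob (A \<union> B n)"
    proof (rule finite_measure_mono)
      show "{\<omega> \<in> space M. R n \<omega> \<le> q - \<eta>} \<subseteq> A \<union> B n"
        using B(3)[of _ n] by (fastforce simp: A_def)
    qed (use B(1) meas in \<open>auto simp: A_def\<close>)
    also have "\<dots> \<le> prob A + prob (B n)"
      using B(1) meas[of n] by (intro measure_Un_le) (auto simp: A_def)
    finally have 2: "prob {\<omega> \<in> space M. R n \<omega> \<le> q - \<eta>} \<le> prob A + prob (B n)" .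
    show ?case
      using elim 1 2 upper lower unfolding A_def[symmetric] dist_real_def by linarith
  qed
qed

text \<open>Coordinates of the sum have additive variances, so the scaled mean square is bounded
  independently of n. It is an equality for positive n; for n = 0 the left side is 0 by the
  convention on division.\<close>

lemma (in prob_space) sample_mean_mean_square:
  fixes Y :: "nat \<Rightarrow> 'a \<Rightarrow> 'b::euclidean_space"
  assumes indep: "indep_vars (\<lambda>_. borel) Y UNIV"
    and distr: "\<And>i. distr M borel (Y i) = N"
    and sq: "integrable N (\<lambda>y. (norm y)\<^sup>2)"
    and mean: "(LINT y|N. y) = 0"
  shows "integrable M (\<lambda>\<omega>. real n * (norm ((\<Sum>i<n. Y i \<omega>) /\<^sub>R real n))\<^sup>2)"
    and "expectation (\<lambda>\<omega>. real n * (norm ((\<Sum>i<n. Y i \<omega>) /\<^sub>R real n))\<^sup>2) \<le> (LINT y|N. (norm y)\<^sup>2)"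
proof -
  have Y[measurable]: "random_variable borel (Y i)" for i
    using indep by (simp add: indep_vars_def)
  have sets_N[measurable_cong]: "sets N = sets borel"
    using distr[of 0] by auto
  interpret N: prob_space N
    unfolding distr[of 0, symmetric] by (rule prob_space_distr) simp
  have int_N: "integrable N (\<lambda>y. y)"
  proof -
    have "integrable N norm"
      by (rule N.square_integrable_imp_integrable[OF _ sq]) measurable
    then show ?thesis
      by (rule integrable_norm_cancel) measurable
  qed
  have sq_b: "integrable N (\<lambda>y. (y \<bullet> b)\<^sup>2)" if "b \<in> Basis" for b
  proof (rule Bochner_Integration.integrable_bound[OF sq])
    have "(y \<bullet> b)\<^sup>2 \<le> (norm y)\<^sup>2" for y
      using Basis_le_norm[OF that, of y] by (intro abs_le_square_iff[THEN iffD1]) simp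
    then show "AE y in N. norm ((y \<bullet> b)\<^sup>2) \<le> norm ((norm y)\<^sup>2)"
      by simp
  qed measurable
  have sum_b: "integrable M (\<lambda>\<omega>. (\<Sum>i<n. Y i \<omega> \<bullet> b)\<^sup>2)"
    "expectation (\<lambda>\<omega>. (\<Sum>i<n. Y i \<omega> \<bullet> b)\<^sup>2) = real n * (LINT y|N. (y \<bullet> b)\<^sup>2)" if b: "b \<in> Basis" for b
  proof -
    have eq: "integrable M (\<lambda>\<omega>. (Y i \<omega> \<bullet> b)\<^sup>2)" "expectation (\<lambda>\<omega>. (Y i \<omega> \<bullet> b)\<^sup>2) = (LINT y|N. (y \<bullet> b)\<^sup>2)" for i
      using sq_b[OF b] unfolding distr[of i, symmetric] by (simp_all add: integrable_distr_eq integral_distr)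
    have "expectation (\<lambda>\<omega>. Y i \<omega> \<bullet> b) = (LINT y|N. y \<bullet> b)" for i
      unfolding distr[of i, symmetric] by (simp add: integral_distr)
    then have "expectation (\<lambda>\<omega>. Y i \<omega> \<bullet> b) = 0" for i
      using integral_inner_left[OF int_N, of b] mean by simp
    moreover have "indep_vars (\<lambda>_. borel) (\<lambda>i \<omega>. Y i \<omega> \<bullet> b) UNIV"
      by (rule indep_vars_compose2[OF indep, where Y = "\<lambda>_ y. y \<bullet> b"]) measurable
    ultimately show "integrable M (\<lambda>\<omega>. (\<Sum>i<n. Y i \<omega> \<bullet> b)\<^sup>2)"
      "expectation (\<lambda>\<omega>. (\<Sum>i<n. Y i \<omega> \<bullet> b)\<^sup>2) = real n * (LINT y|N. (y \<bullet> b)\<^sup>2)"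
      using second_moment_sum[of "\<lambda>i \<omega>. Y i \<omega> \<bullet> b" n] eq by simp_all
  qed
  have norm_sq: "(norm v)\<^sup>2 = (\<Sum>b\<in>Basis. (v \<bullet> b)\<^sup>2)" for v :: 'b
    unfolding power2_norm_eq_inner by (subst euclidean_inner) (simp add: power2_eq_square)
  have eq: "real n * (norm ((\<Sum>i<n. Y i \<omega>) /\<^sub>R real n))\<^sup>2 = (\<Sum>b\<in>Basis. (\<Sum>i<n. Y i \<omega> \<bullet> b)\<^sup>2) / real n" for \<omega>
    by (cases "n = 0")
      (auto simp: power_mult_distrib power2_eq_square divide_simps inner_sum_left
        norm_sq[of "\<Sum>i<n. Y i \<omega>", unfolded power2_eq_square])
  show "integrable M (\<lambda>\<omega>. real n * (norm ((\<Sum>i<n. Y i \<omega>) /\<^sub>R real n))\<^sup>2)"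
    unfolding eq by (intro integrable_divide_zero Bochner_Integration.integrable_sum sum_b) auto
  have "expectation (\<lambda>\<omega>. real n * (norm ((\<Sum>i<n. Y i \<omega>) /\<^sub>R real n))\<^sup>2) =
      (\<Sum>b\<in>Basis. real n * (LINT y|N. (y \<bullet> b)\<^sup>2)) / real n"
    unfolding eq using sum_b by simp
  also have "\<dots> \<le> (\<Sum>b\<in>Basis. (LINT y|N. (y \<bullet> b)\<^sup>2))"
    by (cases "n = 0") (auto simp: sum_distrib_left[symmetric] intro!: sum_nonneg integral_nonneg_AE)
  also have "\<dots> = (LINT y|N. (norm y)\<^sup>2)"
    unfolding norm_sq by (rule Bochner_Integration.integral_sum[symmetric]) (rule sq_b)
  finally show "expectation (\<lambda>\<omega>. real n * (norm ((\<Sum>i<n. Y i \<omega>) /\<^sub>R real n))\<^sup>2) \<le> (LINT y|N. (norm y)\<^sup>2)" .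
qed

text \<open>Second moments are assumed for the first component only. The second component therefore
  enters through the law of large numbers, and the remainder in \<open>expansion\<close> must be
  relative to the deviation of the first component: multiplied by n, its square has bounded mean,
  which is not granted for the deviation of the full pair.\<close>

theorem (in prob_space) delta_method_chi_square:
  fixes Z :: "nat \<Rightarrow> 'a \<Rightarrow> 'b::euclidean_space \<times> 'c::euclidean_space"
    and A :: "'b \<Rightarrow> real ^ 'd"
  assumes indep: "indep_vars (\<lambda>_. borel) Z UNIV"
    and distr: "\<And>i. distr M borel (Z i) = N"
    and int: "integrable N (\<lambda>z. z)"
    and sq: "integrable N (\<lambda>z. (norm (fst z))\<^sup>2)"
    and A: "linear A"
    and var: "\<And>u. (LINT z|N. (u \<bullet> A (fst z - fst (LINT z|N. z)))\<^sup>2) = u \<bullet> u"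
    and U: "open U" "(LINT z|N. z) \<in> U"
    and T: "continuous_on U T"
    and expansion: "\<And>\<epsilon>. 0 < \<epsilon> \<Longrightarrow> \<forall>\<^sub>F z in nhds (LINT z|N. z).
      \<bar>T z - (norm (A (fst z - fst (LINT z|N. z))))\<^sup>2\<bar> \<le> \<epsilon> * (norm (fst z - fst (LINT z|N. z)))\<^sup>2"
  defines "avg \<equiv> \<lambda>n \<omega>. (\<Sum>i<n. Z i \<omega>) /\<^sub>R real n"
  shows "{\<omega> \<in> space M. avg n \<omega> \<in> U \<and> real n * T (avg n \<omega>) \<le> q} \<in> events"
    and "(\<lambda>n. prob {\<omega> \<in> space M. avg n \<omega> \<in> U \<and> real n * T (avg n \<omega>) \<le> q}) \<longlonglongrightarrow>
      cdf (chi_square CARD('d)) q"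
proof -
  have Z[measurable]: "random_variable borel (Z i)" for i
    using indep by (simp add: indep_vars_def)
  have sets_N[measurable_cong]: "sets N = sets borel"
    using distr[of 0] by auto
  interpret N: prob_space N
    unfolding distr[of 0, symmetric] by (rule prob_space_distr) simp
  have avg[measurable]: "random_variable borel (avg n)" for n
    unfolding avg_def by measurable
  have [measurable]: "U \<in> sets borel" using U by simp
  have A_meas[measurable]: "A \<in> borel_measurable borel"
    by (intro borel_measurable_continuous_onI linear_continuous_on linear_conv_bounded_linear[THEN iffD1] A)
  define z0 where "z0 = (LINT z|N. z)"
  define \<mu> where "\<mu> = fst z0"
  have ev: "{\<omega> \<in> space M. avg n \<omega> \<in> U \<and> real n * T (avg n \<omega>) \<le> q} \<in> events" for n q
  proof -
    \<comment> \<open>\<open>T\<close> is continuous only on \<open>U\<close>; its extension by 0 is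
      Borel on the whole space and defines the same event.\<close>
    have [measurable]: "(\<lambda>z. indicator U z *\<^sub>R T z) \<in> borel_measurable borel"
      using T U by (intro borel_measurable_continuous_on_indicator) auto
    have "{\<omega> \<in> space M. avg n \<omega> \<in> U \<and> real n * T (avg n \<omega>) \<le> q} =
      {\<omega> \<in> space M. avg n \<omega> \<in> U \<and> real n * (indicator U (avg n \<omega>) *\<^sub>R T (avg n \<omega>)) \<le> q}"
      by auto
    also have "\<dots> \<in> events" by measurable
    finally show ?thesis .
  qed
  then show "{\<omega> \<in> space M. avg n \<omega> \<in> U \<and> real n * T (avg n \<omega>) \<le> q} \<in> events" .

  have int_fst: "integrable N fst" and mean_fst: "(LINT z|N. fst z) = \<mu>"
    using int by (auto simp: \<mu>_def z0_def intro: integrable_bounded_linear[OF bounded_linear_fst]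
        integral_bounded_linear[OF bounded_linear_fst])
  define Y where "Y i \<omega> = fst (Z i \<omega>) - \<mu>" for i \<omega>
  define NY where "NY = distr N borel (\<lambda>z. fst z - \<mu>)"
  have fst_meas[measurable]: "(\<lambda>z. fst z - \<mu>) \<in> borel_measurable (borel :: ('b \<times> 'c) measure)"
    by (intro borel_measurable_continuous_onI continuous_intros)
  have Y_meas[measurable]: "random_variable borel (Y i)" for i
    unfolding Y_def by (rule measurable_compose[OF Z fst_meas])
  have indepY: "indep_vars (\<lambda>_. borel) Y UNIV"
    unfolding Y_def by (rule indep_vars_compose2[OF indep, where Y = "\<lambda>_ z. fst z - \<mu>"]) (rule fst_meas)
  have distrY: "distr M borel (Y i) = NY" for i
    unfolding NY_def distr[of i, symmetric] by (subst distr_distr) (auto simp: comp_def Y_def[abs_def])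
  have sqY: "integrable NY (\<lambda>y. (norm y)\<^sup>2)"
  proof -
    have "integrable N (\<lambda>z. (norm (fst z))\<^sup>2 - 2 * (fst z \<bullet> \<mu>) + (norm \<mu>)\<^sup>2)"
      by (intro Bochner_Integration.integrable_add Bochner_Integration.integrable_diff sq
          integrable_mult_right integrable_inner_left int_fst) simp
    then show ?thesis
      unfolding NY_def
      by (subst integrable_distr_eq)
        (auto simp: power2_norm_eq_inner inner_diff_left inner_diff_right inner_commute algebra_simps)
  qed
  have meanY: "(LINT y|NY. y) = 0"
    unfolding NY_def using int_fst mean_fst by (subst integral_distr) (auto simp: N.prob_space)
  define K where "K = (LINT y|NY. (norm y)\<^sup>2)"
  have K: "0 \<le> K" unfolding K_def by (rule integral_nonneg_AE) auto
  have avg_Y: "real n * (norm (fst (avg n \<omega>) - \<mu>))\<^sup>2 = real n * (norm ((\<Sum>i<n. Y i \<omega>) /\<^sub>R real n))\<^sup>2" for n \<omega>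
  proof (cases "n = 0")
    case False
    then have "fst (avg n \<omega>) - \<mu> = (\<Sum>i<n. Y i \<omega>) /\<^sub>R real n"
      by (simp add: avg_def Y_def fst_sum sum_subtractf scaleR_diff_right sum_constant_scaleR)
    then show ?thesis by simp
  qed simp
  define R where "R n \<omega> = (norm ((\<Sum>i<n. A (Y i \<omega>)) /\<^sub>R sqrt n))\<^sup>2" for n \<omega>
  have R_eq: "R n \<omega> = real n * (norm (A (fst (avg n \<omega>) - \<mu>)))\<^sup>2" for n \<omega>
  proof (cases "n = 0")
    case False
    then have "fst (avg n \<omega>) - \<mu> = (\<Sum>i<n. Y i \<omega>) /\<^sub>R real n"
      by (simp add: avg_def Y_def fst_sum sum_subtractf scaleR_diff_right sum_constant_scaleR)
    then show ?thesis
      using False by (simp add: R_def linear_sum[OF A] linear_scale[OF A] power_mult_distrib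
          power_inverse power2_eq_square field_simps)
  qed (simp add: R_def)
  have [measurable]: "random_variable borel (R n)" for n
    unfolding R_def by measurable
  define NA where "NA = distr NY borel A"
  have W: "weak_conv_m (\<lambda>n. distr M borel (R n)) (chi_square CARD('d))"
    unfolding R_def
  proof (rule weak_conv_chi_square)
    show "indep_vars (\<lambda>_. borel) (\<lambda>i \<omega>. A (Y i \<omega>)) UNIV"
      by (rule indep_vars_compose2[OF indepY, where Y = "\<lambda>_. A"]) measurable
    show "distr M borel (\<lambda>\<omega>. A (Y i \<omega>)) = NA" for i
      unfolding NA_def distrY[of i, symmetric] by (subst distr_distr) (auto simp: comp_def)
    fix u :: "real ^ 'd"
    have A_bl: "bounded_linear A" using A by (simp add: linear_conv_bounded_linear)
    obtain C where C: "\<And>x. norm (A x) \<le> norm x * C" "0 < C"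
      using bounded_linear.pos_bounded[OF A_bl] by blast
    have int_u: "integrable NY (\<lambda>y. (u \<bullet> A y)\<^sup>2)"
    proof (rule Bochner_Integration.integrable_bound)
      show "integrable NY (\<lambda>y. (norm u * C)\<^sup>2 * (norm y)\<^sup>2)"
        using sqY by simp
      have "(u \<bullet> A y)\<^sup>2 \<le> (norm u * C)\<^sup>2 * (norm y)\<^sup>2" for y
      proof -
        have "\<bar>u \<bullet> A y\<bar> \<le> norm u * (norm y * C)"
          by (intro order_trans[OF Cauchy_Schwarz_ineq2] mult_left_mono C) simp
        then have "\<bar>u \<bullet> A y\<bar>\<^sup>2 \<le> (norm u * (norm y * C))\<^sup>2"
          by (intro power_mono) auto
        then show ?thesis by (simp add: power_mult_distrib ac_simps)
      qed
      then show "AE y in NY. norm ((u \<bullet> A y)\<^sup>2) \<le> norm ((norm u * C)\<^sup>2 * (norm y)\<^sup>2)"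
        by (auto intro!: AE_I2)
    qed (simp add: NY_def)
    then show "integrable M (\<lambda>\<omega>. (u \<bullet> A (Y 0 \<omega>))\<^sup>2)"
      unfolding distrY[of 0, symmetric] by (simp add: integrable_distr_eq)
    have int_NY: "integrable NY (\<lambda>y. y)"
      unfolding NY_def using int_fst by (subst integrable_distr_eq) auto
    have "expectation (\<lambda>\<omega>. u \<bullet> A (Y 0 \<omega>)) = (LINT y|NY. u \<bullet> A y)"
      unfolding distrY[of 0, symmetric] by (simp add: integral_distr)
    also have "\<dots> = u \<bullet> A (LINT y|NY. y)"
      by (intro integral_bounded_linear int_NY bounded_linear_compose[OF bounded_linear_inner_right A_bl, unfolded comp_def])
    finally show "expectation (\<lambda>\<omega>. u \<bullet> A (Y 0 \<omega>)) = 0"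
      by (simp add: meanY linear_0[OF A])
    have "expectation (\<lambda>\<omega>. (u \<bullet> A (Y 0 \<omega>))\<^sup>2) = (LINT y|NY. (u \<bullet> A y)\<^sup>2)"
      unfolding distrY[of 0, symmetric] by (simp add: integral_distr)
    also have "\<dots> = (LINT z|N. (u \<bullet> A (fst z - \<mu>))\<^sup>2)"
      unfolding NY_def by (subst integral_distr) auto
    finally show "expectation (\<lambda>\<omega>. (u \<bullet> A (Y 0 \<omega>))\<^sup>2) = u \<bullet> u"
      using var by (simp add: \<mu>_def z0_def)
  qed
  define E where "E n = {\<omega> \<in> space M. avg n \<omega> \<in> U}" for n
  have "(\<lambda>n. prob {\<omega> \<in> space M. \<omega> \<in> E n \<and> real n * T (avg n \<omega>) \<le> q}) \<longlonglongrightarrow> cdf (chi_square CARD('d)) q"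
  proof (rule prob_le_converges_cdf[OF _ W isCont_cdf_chi_square])
    show "{\<omega> \<in> space M. \<omega> \<in> E n \<and> real n * T (avg n \<omega>) \<le> q} \<in> events" for n
      using ev[of n q] by (simp add: E_def conj_ac cong: conj_cong)
    fix \<eta> \<delta> :: real assume \<eta>: "0 < \<eta>" and \<delta>: "0 < \<delta>"
    \<comment> \<open>Off \<open>B2\<close> the remainder n \<epsilon> |m - \<mu>|^2 is at most
      \<eta>. Markov's inequality bounds the probability of \<open>B2\<close> by K \<epsilon> /
      \<eta> = K / (K + 1) * (\<delta> / 2); adding 1 to K covers the case K = 0.\<close>
    define \<epsilon> where "\<epsilon> = \<eta> * \<delta> / (2 * (K + 1))"
    have \<epsilon>: "0 < \<epsilon>" using \<eta> \<delta> K by (simp add: \<epsilon>_def)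
    have "\<forall>\<^sub>F z in nhds z0. z \<in> U \<and> \<bar>T z - (norm (A (fst z - \<mu>)))\<^sup>2\<bar> \<le> \<epsilon> * (norm (fst z - \<mu>))\<^sup>2"
      unfolding \<mu>_def z0_def
      using expansion[OF \<epsilon>] eventually_nhds_in_open[OF U] by eventually_elim auto
    then obtain V where V: "open V" "z0 \<in> V"
      "\<And>z. z \<in> V \<Longrightarrow> z \<in> U \<and> \<bar>T z - (norm (A (fst z - \<mu>)))\<^sup>2\<bar> \<le> \<epsilon> * (norm (fst z - \<mu>))\<^sup>2"
      unfolding eventually_nhds by blast
    have [measurable]: "V \<in> sets borel" using V by simp
    define B1 where "B1 n = {\<omega> \<in> space M. avg n \<omega> \<notin> V}" for n
    define B2 where "B2 n = {\<omega> \<in> space M. \<eta> / \<epsilon> \<le> real n * (norm (fst (avg n \<omega>) - \<mu>))\<^sup>2}" for n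
    have B12[measurable]: "B1 n \<in> events" "B2 n \<in> events" for n
      unfolding B1_def B2_def by measurable
    have "(\<lambda>n. prob {\<omega> \<in> space M. avg n \<omega> \<in> V}) \<longlonglongrightarrow> 1"
      unfolding avg_def by (rule lln_in_probability[OF indep distr int V(1) V(2)[unfolded z0_def]])
    moreover have "prob (B1 n) = 1 - prob {\<omega> \<in> space M. avg n \<omega> \<in> V}" for n
      unfolding B1_def by (rule prob_neg) measurable
    ultimately have "(\<lambda>n. prob (B1 n)) \<longlonglongrightarrow> 1 - 1"
      by (simp only: tendsto_diff tendsto_const)
    then have B1: "\<forall>\<^sub>F n in sequentially. prob (B1 n) < \<delta> / 2"
      using \<delta> by (intro order_tendstoD(2)) auto
    have B2: "prob (B2 n) \<le> \<delta> / 2" for n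
    proof -
      note ms = sample_mean_mean_square[OF indepY distrY sqY meanY, of n]
      have "prob (B2 n) \<le> expectation (\<lambda>\<omega>. real n * (norm (fst (avg n \<omega>) - \<mu>))\<^sup>2) / (\<eta> / \<epsilon>)"
        unfolding B2_def using \<eta> \<epsilon> ms(1)
        by (intro integral_Markov_inequality_measure[where A = "{}"]) (auto simp: avg_Y)
      also have "\<dots> \<le> K / (\<eta> / \<epsilon>)"
        using ms(2) \<eta> \<epsilon> by (intro divide_right_mono) (auto simp: K_def avg_Y)
      also have "\<dots> = K / (K + 1) * (\<delta> / 2)"
        using \<eta> by (simp add: \<epsilon>_def)
      also have "\<dots> \<le> 1 * (\<delta> / 2)"
        using K \<delta> by (intro mult_right_mono) auto
      finally show ?thesis by simp
    qed
    show "\<exists>B. (\<forall>n. B n \<in> events) \<and> (\<forall>\<^sub>F n in sequentially. prob (B n) \<le> \<delta>) \<and>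
      (\<forall>n. \<forall>\<omega>\<in>space M - B n. \<omega> \<in> E n \<and> \<bar>real n * T (avg n \<omega>) - R n \<omega>\<bar> \<le> \<eta>)"
    proof (intro exI[of _ "\<lambda>n. B1 n \<union> B2 n"] conjI allI ballI)
      show "\<forall>\<^sub>F n in sequentially. prob (B1 n \<union> B2 n) \<le> \<delta>"
        using B1
      proof eventually_elim
        case (elim n)
        then show ?case
          using B2[of n] measure_Un_le[OF B12, of n n] by linarith
      qed
      fix n \<omega> assume \<omega>: "\<omega> \<in> space M - (B1 n \<union> B2 n)"
      then have inV: "avg n \<omega> \<in> V" and small: "real n * (norm (fst (avg n \<omega>) - \<mu>))\<^sup>2 \<le> \<eta> / \<epsilon>"
        by (auto simp: B1_def B2_def)
      show "\<omega> \<in> E n" using V(3)[OF inV] \<omega> by (simp add: E_def)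
      have "\<bar>real n * T (avg n \<omega>) - R n \<omega>\<bar> = real n * \<bar>T (avg n \<omega>) - (norm (A (fst (avg n \<omega>) - \<mu>)))\<^sup>2\<bar>"
        unfolding R_eq right_diff_distrib[symmetric] abs_mult by simp
      also have "\<dots> \<le> real n * (\<epsilon> * (norm (fst (avg n \<omega>) - \<mu>))\<^sup>2)"
        using V(3)[OF inV] by (intro mult_left_mono) auto
      also have "\<dots> \<le> \<epsilon> * (\<eta> / \<epsilon>)"
        using mult_left_mono[OF small, of \<epsilon>] \<epsilon> by (simp add: ac_simps)
      finally show "\<bar>real n * T (avg n \<omega>) - R n \<omega>\<bar> \<le> \<eta>"
        using \<epsilon> by simp
    qed simp
  qed (simp_all add: zero_less_card_finite)
  then show "(\<lambda>n. prob {\<omega> \<in> space M. avg n \<omega> \<in> U \<and> real n * T (avg n \<omega>) \<le> q}) \<longlonglongrightarrow> cdf (chi_square CARD('d)) q"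
    by (simp add: E_def conj_ac cong: conj_cong)
qed

section \<open>Second moments of the embedded sample\<close>

definition outer :: "real ^ 'n \<Rightarrow> real ^ 'n ^ 'n" where
  "outer v = (\<chi> a b. v $ a * v $ b)"

lemma outer_nth: "outer v $ a $ b = v $ a * v $ b"
  by (simp add: outer_def)

text \<open>Row a is v_a times v. Thus a finite second moment of v is exactly what integrability of
  its outer product requires.\<close>

lemma norm_outer: "norm (outer v) = (norm v)\<^sup>2"
proof -
  have "outer v $ a = v $ a *\<^sub>R v" for a
    by (simp add: outer_def vec_eq_iff)
  then have "norm (outer v) = L2_set (\<lambda>a. \<bar>v $ a\<bar> * norm v) UNIV"
    by (simp add: norm_vec_def[of "outer v"])
  also have "\<dots> = L2_set (\<lambda>a. \<bar>v $ a\<bar>) UNIV * norm v"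
    by (rule L2_set_left_distrib[symmetric]) simp
  also have "\<dots> = (norm v)\<^sup>2"
    by (simp add: norm_vec_def[of v] power2_eq_square)
  finally show ?thesis .
qed

lemma inner_outer: "w \<bullet> (outer v *v w) = (w \<bullet> v)\<^sup>2"
  by (simp add: outer_def inner_vec_def matrix_vector_mult_def power2_eq_square sum_product
      sum_distrib_left ac_simps)

lemma continuous_on_outer: "continuous_on S f \<Longrightarrow> continuous_on S (\<lambda>x. outer (f x))"
  unfolding outer_def by (intro continuous_intros)

lemma linear_quadratic_form: "linear (\<lambda>A :: real ^ 'n ^ 'n. w \<bullet> (A *v w))"
  by (rule linearI) (simp_all add: matrix_vector_mult_add_rdistrib inner_add_right scaleR_matrix_vector_assoc[symmetric])

lemma quadratic_form_conj:
  fixes D :: "real ^ 'n ^ 'm"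
  shows "v \<bullet> ((D ** S ** transpose D) *v v) = (transpose D *v v) \<bullet> (S *v (transpose D *v v))"
  by (simp add: matrix_vector_mul_assoc[symmetric] inner_matrix_vector_mult)

lemma transpose_conj:
  fixes D :: "real ^ 'n ^ 'm"
  shows "transpose S = S \<Longrightarrow> transpose (D ** S ** transpose D) = D ** S ** transpose D"
  by (simp add: matrix_transpose_mul matrix_mul_assoc)

text \<open>The sample covariance is centred at the sample mean, so its summands are not
  independent. The uncentred second moments are an average of independent terms, from which the
  covariance is recovered by subtracting the outer square of the mean.\<close>

definition moments :: "('m \<Rightarrow> real ^ 'k) \<Rightarrow> 'm \<Rightarrow> (real ^ 'k) \<times> (real ^ 'k ^ 'k)" where
  "moments j x = (j x, outer (j x))"

lemma sample_moments:
  fixes j :: "'m \<Rightarrow> real ^ 'k"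
  defines "avg \<equiv> \<lambda>n x. (\<Sum>r<n. moments j (x r)) /\<^sub>R real n"
  shows "fst (avg n x) = sample_mean j n x"
    and "snd (avg n x) - outer (fst (avg n x)) = sample_cov j n x"
proof -
  show m: "fst (avg n x) = sample_mean j n x"
    by (simp add: avg_def moments_def sample_mean_def fst_sum divide_inverse)
  show "snd (avg n x) - outer (fst (avg n x)) = sample_cov j n x"
  proof (cases "n = 0")
    case True
    then show ?thesis
      by (simp add: avg_def sample_cov_def outer_def vec_eq_iff)
  next
    case False
    define \<mu> where "\<mu> = sample_mean j n x"
    have \<mu>: "(\<Sum>r<n. j (x r) $ a) = real n * \<mu> $ a" for a
      using False by (simp add: \<mu>_def sample_mean_def)
    have "sample_cov j n x $ a $ b = (snd (avg n x) - outer \<mu>) $ a $ b" for a b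
    proof -
      have "(\<Sum>r<n. (j (x r) - \<mu>) $ a * (j (x r) - \<mu>) $ b) =
          (\<Sum>r<n. j (x r) $ a * j (x r) $ b - \<mu> $ b * j (x r) $ a - \<mu> $ a * j (x r) $ b + \<mu> $ a * \<mu> $ b)"
        by (intro sum.cong) (auto simp: algebra_simps)
      also have "\<dots> = (\<Sum>r<n. j (x r) $ a * j (x r) $ b) - real n * (\<mu> $ a * \<mu> $ b)"
        unfolding sum.distrib sum_subtractf sum_distrib_left[symmetric] \<mu> by simp
      finally show ?thesis
        using False
        by (simp add: sample_cov_def \<mu>_def[symmetric] avg_def moments_def snd_sum outer_def field_simps)
    qed
    then show ?thesis
      unfolding m by (simp add: vec_eq_iff \<mu>_def)
  qed
qed

lemma sample_cov_symmetric: "transpose (sample_cov j n x) = sample_cov j n x"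
  by (simp add: sample_cov_def transpose_def vec_eq_iff mult.commute)

lemma sample_cov_psd: "0 \<le> w \<bullet> (sample_cov j n x *v w)"
proof -
  have "sample_cov j n x = (1 / real n) *\<^sub>R (\<Sum>r<n. outer (j (x r) - sample_mean j n x))"
    by (simp add: sample_cov_def outer_def)
  then show ?thesis
    by (simp only: linear_scale[OF linear_quadratic_form] linear_sum[OF linear_quadratic_form] inner_outer)
      (auto intro!: divide_nonneg_nonneg sum_nonneg)
qed

lemma G_mat_symmetric: "transpose (G_mat j \<iota> e n x) = G_mat j \<iota> e n x"
  unfolding G_mat_def by (rule transpose_conj) (rule sample_cov_symmetric)

lemma G_mat_psd: "0 \<le> v \<bullet> (G_mat j \<iota> e n x *v v)"
  unfolding G_mat_def quadratic_form_conj by (rule sample_cov_psd)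

lemma integrable_outer:
  fixes f :: "'a \<Rightarrow> real ^ 'k"
  assumes "f \<in> borel_measurable M" "integrable M (\<lambda>x. (norm (f x))\<^sup>2)"
  shows "integrable M (\<lambda>x. outer (f x))"
proof (rule Bochner_Integration.integrable_bound[OF assms(2)])
  have "outer \<in> borel_measurable borel"
    by (intro borel_measurable_continuous_onI continuous_on_outer continuous_on_id)
  then show "(\<lambda>x. outer (f x)) \<in> borel_measurable M"
    by (rule measurable_compose[OF assms(1)])
qed (simp add: norm_outer)

context
  fixes Q :: "'m measure" and j :: "'m \<Rightarrow> real ^ 'k"
  assumes Q: "prob_space Q" and j: "j \<in> borel_measurable Q"
    and sq: "integrable Q (\<lambda>x. (norm (j x))\<^sup>2)"
begin

lemma integrable_j: "integrable Q j"
proof -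
  interpret prob_space Q by (rule Q)
  have "integrable Q (\<lambda>x. norm (j x))"
    by (rule square_integrable_imp_integrable[OF _ sq]) (use j in measurable)
  then show ?thesis
    by (rule integrable_norm_cancel) (rule j)
qed

lemma integrable_sq_centered: "integrable Q (\<lambda>x. (norm (j x - c))\<^sup>2)"
proof -
  interpret prob_space Q by (rule Q)
  have "integrable Q (\<lambda>x. (norm (j x))\<^sup>2 - 2 * (j x \<bullet> c) + (norm c)\<^sup>2)"
    by (intro Bochner_Integration.integrable_add Bochner_Integration.integrable_diff sq
        integrable_mult_right integrable_inner_left integrable_j) simp
  also have "(\<lambda>x. (norm (j x))\<^sup>2 - 2 * (j x \<bullet> c) + (norm c)\<^sup>2) = (\<lambda>x. (norm (j x - c))\<^sup>2)"
    by (auto simp: power2_norm_eq_inner inner_diff_left inner_diff_right inner_commute algebra_simps)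
  finally show ?thesis .
qed

lemma integral_nth_nth:
  fixes f :: "'m \<Rightarrow> real ^ 'k ^ 'k"
  assumes "integrable Q f"
  shows "(LINT x|Q. f x) $ a $ b = (LINT x|Q. f x $ a $ b)"
  using assms
  by (intro integral_bounded_linear[symmetric] bounded_linear_compose[OF bounded_linear_vec_nth bounded_linear_vec_nth, unfolded comp_def])

lemma emb_cov_eq: "emb_cov j Q = (LINT x|Q. outer (j x - emb_mean j Q))"
proof -
  have "integrable Q (\<lambda>x. outer (j x - emb_mean j Q))"
    by (rule integrable_outer[OF borel_measurable_diff[OF j borel_measurable_const] integrable_sq_centered])
  from integral_nth_nth[OF this] show ?thesis
    by (simp add: vec_eq_iff emb_cov_def outer_def)
qed

text \<open>The form at w is the variance of w \<bullet> j(X). This gives semidefiniteness of the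
  extrinsic covariance and the variance computation for the linearised statistic.\<close>

lemma emb_cov_quadratic_form: "w \<bullet> (emb_cov j Q *v w) = (LINT x|Q. (w \<bullet> (j x - emb_mean j Q))\<^sup>2)"
proof -
  have "integrable Q (\<lambda>x. outer (j x - emb_mean j Q))"
    by (rule integrable_outer[OF borel_measurable_diff[OF j borel_measurable_const] integrable_sq_centered])
  then show ?thesis
    unfolding emb_cov_eq inner_outer[symmetric]
    by (intro integral_bounded_linear[symmetric] linear_conv_bounded_linear[THEN iffD1] linear_quadratic_form)
qed

lemma integrable_moments: "integrable Q (moments j)"
proof (rule Bochner_Integration.integrable_bound)
  show "integrable Q (\<lambda>x. norm (j x) + (norm (j x))\<^sup>2)"
    by (intro Bochner_Integration.integrable_add integrable_norm integrable_j sq)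
  have "(\<lambda>v. (v, outer v)) \<in> borel_measurable borel"
    by (intro borel_measurable_continuous_onI continuous_intros continuous_on_outer)
  then show "moments j \<in> borel_measurable Q"
    unfolding moments_def[abs_def] by (rule measurable_compose[OF j])
  show "AE x in Q. norm (moments j x) \<le> norm (norm (j x) + (norm (j x))\<^sup>2)"
    by (intro AE_I2) (simp add: moments_def order_trans[OF norm_Pair_le] norm_outer)
qed

lemma fst_mean_moments: "fst (LINT x|Q. moments j x) = emb_mean j Q"
  unfolding emb_mean_def using integral_bounded_linear[OF bounded_linear_fst integrable_moments]
  by (simp add: moments_def[abs_def])

lemma mean_moments_cov: "snd (LINT x|Q. moments j x) - outer (fst (LINT x|Q. moments j x)) = emb_cov j Q"
proof -
  interpret prob_space Q by (rule Q)
  define \<mu> where "\<mu> = emb_mean j Q"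
  have int_o: "integrable Q (\<lambda>x. outer (j x))"
    by (rule integrable_outer[OF j sq])
  have snd: "snd (LINT x|Q. moments j x) = (LINT x|Q. outer (j x))"
    using integral_bounded_linear[OF bounded_linear_snd integrable_moments] by (simp add: moments_def[abs_def])
  have int_nth: "integrable Q (\<lambda>x. j x $ a)" and mean_nth: "(LINT x|Q. j x $ a) = \<mu> $ a" for a
    using integrable_bounded_linear[OF bounded_linear_vec_nth integrable_j, of a]
      integral_bounded_linear[OF bounded_linear_vec_nth integrable_j, of a]
    by (simp_all add: \<mu>_def emb_mean_def)
  have int_ab: "integrable Q (\<lambda>x. j x $ a * j x $ b)" for a b
    using integrable_bounded_linear[OF bounded_linear_vec_nth integrable_bounded_linear[OF bounded_linear_vec_nth int_o], of b a]
    by (simp add: outer_def mult.commute)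
  have "emb_cov j Q $ a $ b = (LINT x|Q. j x $ a * j x $ b) - \<mu> $ a * \<mu> $ b" for a b
  proof -
    have "emb_cov j Q $ a $ b =
      (LINT x|Q. j x $ a * j x $ b - \<mu> $ b * j x $ a - \<mu> $ a * j x $ b + \<mu> $ a * \<mu> $ b)"
      unfolding emb_cov_def \<mu>_def[symmetric] by (simp add: algebra_simps)
    also have "\<dots> = (LINT x|Q. j x $ a * j x $ b) - \<mu> $ a * \<mu> $ b"
      using int_nth int_ab by (simp add: mean_nth prob_space)
    finally show ?thesis .
  qed
  then show ?thesis
    unfolding fst_mean_moments snd \<mu>_def[symmetric]
    by (simp add: vec_eq_iff integral_nth_nth[OF int_o] outer_nth)
qed

end

section \<open>Projection and tangential components\<close>

lemma C1_nonfocal_points_open: "open (C1_nonfocal_points j)"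
proof -
  have "C1_nonfocal_points j = \<Union> {N. open N \<and> (\<forall>y\<in>N. nonfocal (range j) y) \<and> C_k_on 1 (proj j) N}"
    unfolding C1_nonfocal_points_def by blast
  then show ?thesis by (simp add: open_Union)
qed

lemma C1_nonfocal_points_differentiable:
  assumes "x \<in> C1_nonfocal_points j"
  shows "proj j differentiable at x"
    and "isCont (\<lambda>y. frechet_derivative (proj j) (at y) v) x"
proof -
  obtain N where N: "open N" "x \<in> N" "C_k_on 1 (proj j) N"
    using assms by (auto simp: C1_nonfocal_points_def)
  then show "proj j differentiable at x"
    by (simp add: One_nat_def)
  have "continuous_on N (\<lambda>y. frechet_derivative (proj j) (at y) v)"
    using N(3) by (simp add: One_nat_def)
  then show "isCont (\<lambda>y. frechet_derivative (proj j) (at y) v) x"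
    using N by (simp add: continuous_on_eq_continuous_at)
qed

lemma continuous_on_proj: "continuous_on (C1_nonfocal_points j) (proj j)"
  by (intro continuous_at_imp_continuous_on ballI differentiable_imp_continuous_within
      C1_nonfocal_points_differentiable(1))

lemma tan_comp_linear: "linear (tan_comp \<iota> e q)"
  by (rule linearI) (simp_all add: tan_comp_def vec_eq_iff inner_add_right)

lemma norm_tan_comp_le: "norm (tan_comp \<iota> e q v) \<le> (\<Sum>a\<in>UNIV. norm (e (\<iota> a) q)) * norm v"
proof -
  have "norm (tan_comp \<iota> e q v) \<le> (\<Sum>a\<in>UNIV. \<bar>tan_comp \<iota> e q v $ a\<bar>)"
    by (rule norm_le_l1_cart)
  also have "\<dots> \<le> (\<Sum>a\<in>UNIV. norm (e (\<iota> a) q) * norm v)"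
    by (intro sum_mono) (simp add: tan_comp_def Cauchy_Schwarz_ineq2)
  finally show ?thesis by (simp add: sum_distrib_right)
qed

text \<open>The frame is evaluated at a moving point c m, of which only the limit p \<mu> matters: p
  m - p \<mu> is of first order, so the variation of the frame contributes a product of two small
  quantities. A constant c gives region (a), the projection itself region (b).\<close>

lemma tan_comp_expansion:
  fixes p c :: "real ^ 'k \<Rightarrow> real ^ 'k" and \<iota> :: "'d::finite \<Rightarrow> 'k"
  assumes p: "(p has_derivative p') (at \<mu>)" and e: "\<And>a. isCont (e (\<iota> a)) (p \<mu>)"
    and c: "(c \<longlongrightarrow> p \<mu>) (nhds \<mu>)" and \<epsilon>: "0 < \<epsilon>"
  shows "\<forall>\<^sub>F m in nhds \<mu>. norm (tan_comp \<iota> e (c m) (p m - p \<mu>) - tan_comp \<iota> e (p \<mu>) (p' (m - \<mu>)))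
    \<le> \<epsilon> * norm (m - \<mu>)"
proof -
  obtain C where C: "0 < C" "\<And>x. norm (p' x) \<le> norm x * C"
    using bounded_linear.pos_bounded[OF has_derivative_bounded_linear[OF p]] by blast
  define \<Delta> where "\<Delta> m = (\<Sum>a\<in>UNIV. norm (e (\<iota> a) (c m) - e (\<iota> a) (p \<mu>)))" for m
  define B where "B m = (\<Sum>a\<in>UNIV. norm (e (\<iota> a) (c m)))" for m
  \<comment> \<open>An eventual strict bound for the frame norms. The tolerance is halved:
    \<epsilon> / (2 * B0) goes to the remainder of the derivative and \<epsilon> / (2 * C) to the
    variation of the frame.\<close>
  define B0 where "B0 = (\<Sum>a\<in>UNIV. norm (e (\<iota> a) (p \<mu>))) + 1"
  have B0: "0 < B0" by (auto simp: B0_def intro!: add_nonneg_pos sum_nonneg)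
  have ec: "((\<lambda>m. e (\<iota> a) (c m)) \<longlongrightarrow> e (\<iota> a) (p \<mu>)) (nhds \<mu>)" for a
    using e c by (rule isCont_tendsto_compose)
  have "(\<Delta> \<longlongrightarrow> (\<Sum>a\<in>(UNIV::'d set). norm (e (\<iota> a) (p \<mu>) - e (\<iota> a) (p \<mu>)))) (nhds \<mu>)"
    unfolding \<Delta>_def by (intro tendsto_intros ec)
  then have \<Delta>: "\<forall>\<^sub>F m in nhds \<mu>. \<Delta> m < \<epsilon> / (2 * C)"
    using \<epsilon> C by (intro order_tendstoD(2)) auto
  have "(B \<longlongrightarrow> (\<Sum>a\<in>(UNIV::'d set). norm (e (\<iota> a) (p \<mu>)))) (nhds \<mu>)"
    unfolding B_def by (intro tendsto_intros ec)
  then have B: "\<forall>\<^sub>F m in nhds \<mu>. B m < B0"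
    by (rule order_tendstoD) (simp add: B0_def)
  have "0 < \<epsilon> / (2 * B0)"
    using \<epsilon> B0 by simp
  then obtain d where d: "0 < d" "\<And>m. norm (m - \<mu>) < d \<Longrightarrow>
      norm (p m - p \<mu> - p' (m - \<mu>)) \<le> \<epsilon> / (2 * B0) * norm (m - \<mu>)"
    using p unfolding has_derivative_at_alt by blast
  have "\<forall>\<^sub>F m in nhds \<mu>. norm (m - \<mu>) < d"
    unfolding eventually_nhds_metric dist_norm using d(1) by blast
  with \<Delta> B show ?thesis
  proof eventually_elim
    case (elim m)
    define r where "r = p m - p \<mu> - p' (m - \<mu>)"
    \<comment> \<open>The difference of frames is itself inserted as a frame, which lets the same
      norm bound handle both summands.\<close>
    have "tan_comp \<iota> e (c m) (p m - p \<mu>) - tan_comp \<iota> e (p \<mu>) (p' (m - \<mu>)) =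
        tan_comp \<iota> e (c m) r + tan_comp \<iota> (\<lambda>b q. e b (c m) - e b q) (p \<mu>) (p' (m - \<mu>))"
      by (simp add: tan_comp_def vec_eq_iff r_def inner_diff_left inner_diff_right)
    also have "norm \<dots> \<le> B m * norm r + \<Delta> m * norm (p' (m - \<mu>))"
      unfolding B_def \<Delta>_def by (intro norm_triangle_mono norm_tan_comp_le)
    also have "\<dots> \<le> B0 * (\<epsilon> / (2 * B0) * norm (m - \<mu>)) + \<epsilon> / (2 * C) * (norm (m - \<mu>) * C)"
      using elim d(2)[of m] B0 C \<epsilon> by (intro add_mono mult_mono) (auto simp: r_def)
    also have "\<dots> = \<epsilon> * norm (m - \<mu>)"
      using B0 C by (simp add: field_simps)
    finally show ?case .
  qed
qed

text \<open>Identifies the matrix D(x) with the tangential part of the derivative of the projection,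
  so that the linear term of the expansion becomes D(\<mu>) (m - \<mu>).\<close>

lemma D_mat_mult:
  fixes j :: "'m \<Rightarrow> real ^ 'k" and \<iota> :: "'d::finite \<Rightarrow> 'k"
  assumes "proj j differentiable at x"
  shows "D_mat j \<iota> e x *v h = tan_comp \<iota> e (proj j x) (frechet_derivative (proj j) (at x) h)"
proof -
  define L where "L h = tan_comp \<iota> e (proj j x) (frechet_derivative (proj j) (at x) h)" for h
  have "linear L"
    unfolding L_def using linear_compose[OF linear_frechet_derivative[OF assms] tan_comp_linear]
    by (simp add: comp_def)
  moreover have "D_mat j \<iota> e x = matrix L"
    by (simp add: D_mat_def matrix_def L_def tan_comp_def inner_commute)
  ultimately show ?thesis
    unfolding L_def[symmetric] by (simp add: matrix_works linear_matrix_vector_mul_eq)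
qed

section \<open>Coverage probabilities of the two regions\<close>

theorem corollary3p2:
  fixes A :: "('m::{t2_space, second_countable_topology}, 'd::finite) chart set"
    and j :: "'m \<Rightarrow> real ^ 'k::finite"
    and Q :: "'m measure"
    and P :: "'w measure"
    and X :: "nat \<Rightarrow> 'w \<Rightarrow> 'm"
    and \<iota> :: "'d \<Rightarrow> 'k"
    and e :: "'k \<Rightarrow> real ^ 'k \<Rightarrow> real ^ 'k"
    and V :: "(real ^ 'k) set"
    and \<alpha> :: real
  assumes manifold: "smooth_atlas A"
    and embedding: "smooth_embedding A j"
    and closed: "closed (range j)"
    and Q: "prob_space Q" "sets Q = sets borel"
    and P: "prob_space P"
    and indep: "prob_space.indep_vars P (\<lambda>_. borel) X UNIV"
    and distr: "\<And>r. distr P borel (X r) = Q"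
    and nonfocal: "j_nonfocal j Q"
    and moments: "integrable Q (\<lambda>x. (norm (j x))\<^sup>2)"
    and \<iota>: "inj \<iota>"
    and V: "open V" "proj j (emb_mean j Q) \<in> V"
    and frame: "adapted_frame A j \<iota> e V"
    and nonsingular: "invertible (extrinsic_cov j \<iota> e Q)"
    and \<alpha>: "0 < \<alpha>" "\<alpha> < 1"
  shows "asymptotic_confidence_region P X (well_defined_sample j \<iota> e V)
           (region_C j \<iota> e V \<alpha>) (extrinsic_mean j Q) (1 - \<alpha>) \<and>
         asymptotic_confidence_region P X (well_defined_sample j \<iota> e V)
           (region_D j \<iota> e \<alpha>) (extrinsic_mean j Q) (1 - \<alpha>)"
proof -
  interpret P: prob_space P by (rule P)
  have cont_j: "continuous_on UNIV j"
    using embedding by (simp add: smooth_embedding_def homeomorphism_def)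
  have meas_j: "j \<in> borel_measurable borel"
    by (rule borel_measurable_continuous_onI[OF cont_j])
  then have meas_jQ: "j \<in> borel_measurable Q"
    using Q(2) measurable_cong_sets by blast
  have cont_e: "continuous_on V (e b)" for b
    using frame unfolding adapted_frame_def smooth_on_def by (metis C_k_on.simps(1))
  have X: "X r \<in> measurable P borel" for r
    using indep by (simp add: P.indep_vars_def)

  define \<mu> where "\<mu> = emb_mean j Q"
  define \<nu>0 where "\<nu>0 = proj j \<mu>"
  define W where "W = {m \<in> C1_nonfocal_points j. proj j m \<in> V}"
  have \<mu>_W: "\<mu> \<in> W"
    using nonfocal V(2) by (simp add: W_def \<mu>_def j_nonfocal_def)
  have "W = C1_nonfocal_points j \<inter> proj j -` V"
    by (auto simp: W_def)
  then have open_W: "open W"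
    by (simp only: continuous_open_preimage[OF continuous_on_proj C1_nonfocal_points_open V(1)])
  have cont_p: "continuous_on W (proj j)"
    by (rule continuous_on_subset[OF continuous_on_proj]) (auto simp: W_def)
  have cont_ep: "continuous_on W (\<lambda>m. e b (proj j m))" for b
    by (rule continuous_on_compose2[OF cont_e cont_p]) (auto simp: W_def)
  have "continuous_on W (\<lambda>m. frechet_derivative (proj j) (at m) v)" for v
    by (intro continuous_at_imp_continuous_on ballI C1_nonfocal_points_differentiable(2)) (simp add: W_def)
  then have cont_D: "continuous_on W (D_mat j \<iota> e)"
    unfolding D_mat_def by (intro continuous_intros cont_ep)
  have diff_\<mu>: "proj j differentiable at \<mu>"
    using \<mu>_W by (intro C1_nonfocal_points_differentiable(1)) (simp add: W_def)

  define G where "G z = D_mat j \<iota> e (fst z) ** (snd z - outer (fst z)) ** transpose (D_mat j \<iota> e (fst z))"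
    for z :: "(real ^ 'k) \<times> (real ^ 'k ^ 'k)"
  define WW where "WW = fst -` W \<inter> (UNIV :: ((real ^ 'k) \<times> (real ^ 'k ^ 'k)) set)"
  have open_WW: "open WW"
    unfolding WW_def by (intro open_Int open_vimage open_W continuous_intros) auto
  have cont_fst: "continuous_on WW (\<lambda>z. g (fst z))" if "continuous_on W g" for g :: "real ^ 'k \<Rightarrow> 'x::topological_space"
    by (rule continuous_on_compose2[OF that continuous_on_fst[OF continuous_on_id]]) (auto simp: WW_def)
  have cont_G: "continuous_on WW G"
    unfolding G_def[abs_def]
    by (intro continuous_on_matrix_mult continuous_on_transpose continuous_on_diff continuous_on_outer
        cont_fst[OF cont_D] continuous_on_fst continuous_on_snd continuous_on_id)
  \<comment> \<open>A sample is well defined exactly when its averaged moments lie in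
    \<open>U\<close>. Openness of \<open>U\<close>, obtained from the determinant, makes this event
    measurable and, as \<open>U\<close> contains the expected moments, of probability tending to
    1.\<close>
  define U where "U = {z \<in> WW. invertible (G z)}"
  have U_WW: "U \<subseteq> WW" by (auto simp: U_def)
  have open_U: "open U"
  proof -
    have "continuous_on WW (\<lambda>z. det (G z))"
      by (intro continuous_on_det continuous_intros cont_G)
    then have "open (WW \<inter> (\<lambda>z. det (G z)) -` (- {0}))"
      by (rule continuous_open_preimage[OF _ open_WW]) auto
    also have "WW \<inter> (\<lambda>z. det (G z)) -` (- {0}) = U"
      by (auto simp: U_def invertible_det_nz)
    finally show ?thesis .
  qed

  define Z where "Z i \<omega> = moments j (X i \<omega>)" for i \<omega>
  define avg where "avg n \<omega> = (\<Sum>i<n. Z i \<omega>) /\<^sub>R real n" for n \<omega>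
  have avg: "fst (avg n \<omega>) = sample_mean j n (\<lambda>r. X r \<omega>)"
    "snd (avg n \<omega>) - outer (fst (avg n \<omega>)) = sample_cov j n (\<lambda>r. X r \<omega>)" for n \<omega>
    using sample_moments[where j = j and n = n and x = "\<lambda>r. X r \<omega>"] unfolding avg_def Z_def by auto
  have G_avg: "G (avg n \<omega>) = G_mat j \<iota> e n (\<lambda>r. X r \<omega>)" for n \<omega>
    unfolding G_def G_mat_def avg(2) unfolding avg(1) ..
  have wd: "well_defined_sample j \<iota> e V n (\<lambda>r. X r \<omega>) \<longleftrightarrow> avg n \<omega> \<in> U" for n \<omega>
    unfolding well_defined_sample_def U_def WW_def W_def by (simp add: avg(1) G_avg)

  have cont_moments: "continuous_on UNIV (moments j)"
    unfolding moments_def[abs_def] by (intro continuous_intros continuous_on_outer cont_j)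
  have meas_moments: "moments j \<in> borel_measurable borel"
    by (rule borel_measurable_continuous_onI[OF cont_moments])
  then have meas_momentsQ: "moments j \<in> borel_measurable Q"
    using Q(2) measurable_cong_sets by blast
  define N where "N = distr Q borel (moments j)"
  have distr_Z: "distr P borel (Z i) = N" for i
    unfolding N_def distr[of i, symmetric] Z_def[abs_def]
    by (subst distr_distr[OF meas_moments X]) (simp add: comp_def)
  have indep_Z: "P.indep_vars (\<lambda>_. borel) Z UNIV"
    unfolding Z_def by (rule P.indep_vars_compose2[OF indep]) (rule meas_moments)
  have int_N: "integrable N (\<lambda>z. z)"
    unfolding N_def
    by (subst integrable_distr_eq[OF meas_momentsQ]) (auto intro: integrable_moments[OF Q(1) meas_jQ moments])
  have fst_meas: "fst \<in> borel_measurable (borel :: ((real ^ 'k) \<times> (real ^ 'k ^ 'k)) measure)"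
    by (intro borel_measurable_continuous_onI continuous_on_fst continuous_on_id)
  have sq_N: "integrable N (\<lambda>z. (norm (fst z))\<^sup>2)"
    unfolding N_def using fst_meas
    by (subst integrable_distr_eq[OF meas_momentsQ]) (auto simp: moments_def moments)
  define z0 where "z0 = (LINT z|N. z)"
  have z0: "z0 = (LINT x|Q. moments j x)"
    unfolding z0_def N_def by (rule integral_distr[OF meas_momentsQ]) simp
  have fst_z0: "fst z0 = \<mu>"
    unfolding z0 \<mu>_def by (rule fst_mean_moments[OF Q(1) meas_jQ moments])
  have snd_z0: "snd z0 - outer (fst z0) = emb_cov j Q"
    unfolding z0 by (rule mean_moments_cov[OF Q(1) meas_jQ moments])
  define \<Gamma> where "\<Gamma> = extrinsic_cov j \<iota> e Q"
  have G_z0: "G z0 = \<Gamma>"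
    unfolding G_def snd_z0 unfolding fst_z0 \<Gamma>_def extrinsic_cov_def \<mu>_def ..
  have z0_U: "z0 \<in> U"
    using \<mu>_W nonsingular by (simp add: U_def WW_def fst_z0 G_z0 \<Gamma>_def)

  define D0 where "D0 = D_mat j \<iota> e \<mu>"
  have \<Gamma>_eq: "\<Gamma> = D0 ** emb_cov j Q ** transpose D0"
    by (simp add: \<Gamma>_def D0_def extrinsic_cov_def \<mu>_def)
  have sym_\<Gamma>: "transpose \<Gamma> = \<Gamma>"
    unfolding \<Gamma>_eq
    by (rule transpose_conj) (simp add: emb_cov_def transpose_def vec_eq_iff mult.commute)
  have "0 \<le> v \<bullet> (\<Gamma> *v v)" for v
    unfolding \<Gamma>_eq quadratic_form_conj emb_cov_quadratic_form[OF Q(1) meas_jQ moments]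
    by (rule integral_nonneg_AE) simp
  then have pos_\<Gamma>: "0 < v \<bullet> (\<Gamma> *v v)" if "v \<noteq> 0" for v
    using psd_invertible_imp_posdef[OF sym_\<Gamma>] nonsingular that by (simp add: \<Gamma>_def)
  define B where "B = inv_sqrt \<Gamma>"
  note inv_\<Gamma> = inv_sqrt_posdef[OF sym_\<Gamma> pos_\<Gamma>]
  \<comment> \<open>\<open>B ** \<Gamma>\<close> is a right inverse of the square matrix
    \<open>B\<close>, hence also a left inverse.\<close>
  have "B ** (B ** \<Gamma>) = mat 1"
    using inv_\<Gamma>(2) matrix_inv_mult(2)[OF inv_\<Gamma>(3)] by (simp add: B_def matrix_mul_assoc)
  then have B\<Gamma>B: "B ** \<Gamma> ** B = mat 1"
    by (simp only: matrix_left_right_inverse)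
  \<comment> \<open>From here on \<open>A\<close> denotes the whitening map rather than the atlas:
    applied to j(X), it produces a vector with identity covariance.\<close>
  define A where "A h = B *v (D0 *v h)" for h
  have lin_A: "linear A"
    unfolding A_def[abs_def] matrix_vector_mul_assoc by simp
  have var: "(LINT z|N. (u \<bullet> A (fst z - \<mu>))\<^sup>2) = u \<bullet> u" for u
  proof -
    define w where "w = transpose D0 *v (B *v u)"
    have uA: "u \<bullet> A h = w \<bullet> h" for h
      unfolding A_def w_def inner_matrix_vector_mult using inv_\<Gamma>(1) by (simp add: B_def)
    have A_meas: "(\<lambda>z. (u \<bullet> A (fst z - \<mu>))\<^sup>2) \<in> borel_measurable borel"
      unfolding uA by (intro borel_measurable_continuous_onI continuous_intros)
    have "(LINT z|N. (u \<bullet> A (fst z - \<mu>))\<^sup>2) = (LINT x|Q. (w \<bullet> (j x - \<mu>))\<^sup>2)"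
      unfolding N_def by (subst integral_distr[OF meas_momentsQ A_meas]) (simp add: uA moments_def)
    also have "\<dots> = w \<bullet> (emb_cov j Q *v w)"
      unfolding \<mu>_def by (rule emb_cov_quadratic_form[OF Q(1) meas_jQ moments, symmetric])
    also have "\<dots> = (B *v u) \<bullet> (\<Gamma> *v (B *v u))"
      unfolding w_def \<Gamma>_eq quadratic_form_conj ..
    also have "\<dots> = u \<bullet> (B *v (\<Gamma> *v (B *v u)))"
      unfolding inner_matrix_vector_mult[of u] using inv_\<Gamma>(1) by (simp add: B_def)
    also have "\<dots> = u \<bullet> u"
      using B\<Gamma>B by (simp add: matrix_vector_mul_assoc matrix_mul_assoc)
    finally show ?thesis .
  qed

  define q where "q = quantile (chi_square CARD('d)) (1 - \<alpha>)"
  have cdf_q: "cdf (chi_square CARD('d)) q = 1 - \<alpha>"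
    unfolding q_def
    by (rule cdf_quantile[OF real_distribution_chi_square isCont_cdf_chi_square]) (use \<alpha> in \<open>simp_all add: zero_less_card_finite\<close>)
  have \<nu>0_V: "\<nu>0 \<in> V" using V(2) by (simp add: \<nu>0_def \<mu>_def)
  \<comment> \<open>Closedness of the image places the projection of \<mu> in
    \<open>range j\<close>, where j undoes its inverse.\<close>
  have j_mean: "j (extrinsic_mean j Q) = \<nu>0"
    unfolding extrinsic_mean_def \<nu>0_def \<mu>_def
    by (rule f_inv_into_f) (rule closest_point_in_set[OF closed], simp)

  \<comment> \<open>Both regions are treated at once; c m is the point at which the frame is taken.
    Its values must stay in \<open>V\<close>, where the frame is continuous, and membership of the
    extrinsic mean has to be described on well-defined samples only.\<close>
  have region: "asymptotic_confidence_region P X (well_defined_sample j \<iota> e V) C (extrinsic_mean j Q) (1 - \<alpha>)"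
    if c: "continuous_on W c" "c \<mu> = \<nu>0" "c ` W \<subseteq> V"
      and C: "\<And>n x. well_defined_sample j \<iota> e V n x \<Longrightarrow> extrinsic_mean j Q \<in> C n x \<longleftrightarrow>
        real n * (norm (inv_sqrt (G_mat j \<iota> e n x) *v
          tan_comp \<iota> e (c (sample_mean j n x)) (proj j (sample_mean j n x) - \<nu>0)))\<^sup>2 \<le> q"
    for c :: "real ^ 'k \<Rightarrow> real ^ 'k" and C
  proof -
    define t where "t m = tan_comp \<iota> e (c m) (proj j m - \<nu>0)" for m
    define T where "T z = t (fst z) \<bullet> (matrix_inv (G z) *v t (fst z))" for z
    have cont_ec: "continuous_on W (\<lambda>m. e b (c m))" for b
      by (rule continuous_on_compose2[OF cont_e c(1)]) (use c(3) in auto)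
    have cont_t: "continuous_on W t"
      unfolding t_def[abs_def] tan_comp_def by (intro continuous_intros cont_ec cont_p)
    have cont_inv: "continuous_on U (\<lambda>z. matrix_inv (G z))"
      by (rule continuous_on_matrix_inv[OF continuous_on_subset[OF cont_G U_WW]]) (simp add: U_def)
    have cont_T: "continuous_on U T"
      unfolding T_def[abs_def]
      by (intro continuous_on_inner continuous_on_matrix_vector_mult cont_inv
          continuous_on_subset[OF cont_fst[OF cont_t] U_WW])
    have "\<forall>\<^sub>F z in nhds z0. \<bar>T z - (norm (A (fst z - \<mu>)))\<^sup>2\<bar> \<le> \<epsilon> * (norm (fst z - \<mu>))\<^sup>2"
      if \<epsilon>: "0 < \<epsilon>" for \<epsilon>
    proof -
      have A_sq: "(norm (A h))\<^sup>2 = (D0 *v h) \<bullet> (matrix_inv \<Gamma> *v (D0 *v h))" for h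
        unfolding A_def B_def by (rule norm_inv_sqrt[OF sym_\<Gamma> pos_\<Gamma>])
      have "((\<lambda>z. matrix_inv (G z)) \<longlongrightarrow> matrix_inv \<Gamma>) (nhds z0)"
        using cont_inv z0_U open_U G_z0 continuous_on_eq_continuous_at isCont_def
        by (metis tendsto_at_iff_tendsto_nhds)
      moreover have "\<forall>\<^sub>F z in nhds z0. norm (t (fst z) - D0 *v (fst z - \<mu>)) \<le> \<epsilon>' * norm (fst z - \<mu>)"
        if \<epsilon>': "0 < \<epsilon>'" for \<epsilon>'
      proof -
        have "(c \<longlongrightarrow> proj j \<mu>) (nhds \<mu>)"
          using c(1,2) open_W \<mu>_W continuous_on_eq_continuous_at isCont_def
          unfolding \<nu>0_def by (metis tendsto_at_iff_tendsto_nhds)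
        moreover have "isCont (e (\<iota> a)) (proj j \<mu>)" for a
          using cont_e V(1) \<nu>0_V by (simp add: continuous_on_eq_continuous_at \<nu>0_def)
        moreover have "(proj j has_derivative frechet_derivative (proj j) (at \<mu>)) (at \<mu>)"
          using diff_\<mu> by (simp add: frechet_derivative_works)
        ultimately have "\<forall>\<^sub>F m in nhds \<mu>. norm (t m - D0 *v (m - \<mu>)) \<le> \<epsilon>' * norm (m - \<mu>)"
          unfolding t_def D0_def D_mat_mult[OF diff_\<mu>] \<nu>0_def
          by (intro tan_comp_expansion \<epsilon>')
        moreover have "filterlim fst (nhds \<mu>) (nhds z0)"
          unfolding fst_z0[symmetric] by (intro tendsto_fst) (simp add: filterlim_ident)
        ultimately show ?thesis
          by (rule eventually_compose_filterlim)
      qed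
      ultimately show ?thesis
        unfolding T_def A_sq by (intro quadratic_form_expansion \<epsilon>) simp_all
    qed
    note delta = P.delta_method_chi_square[OF indep_Z distr_Z int_N sq_N lin_A _ open_U _ cont_T,
        folded z0_def avg_def, unfolded fst_z0, OF var z0_U this]
    have well: "{\<omega> \<in> space P. well_defined_sample j \<iota> e V n (\<lambda>r. X r \<omega>)} \<in> sets P" for n
    proof -
      have "Z i \<in> borel_measurable P" for i
        unfolding Z_def by (rule measurable_compose[OF X meas_moments])
      then have "avg n \<in> borel_measurable P"
        unfolding avg_def[abs_def] by measurable
      from measurable_sets[OF this, of U] open_U show ?thesis
        by (simp add: wd vimage_def Int_def conj_commute)
    qed
    have lln: "(\<lambda>n. P.prob {\<omega> \<in> space P. well_defined_sample j \<iota> e V n (\<lambda>r. X r \<omega>)}) \<longlonglongrightarrow> 1"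
      unfolding wd avg_def
      by (rule P.lln_in_probability[OF indep_Z distr_Z int_N open_U z0_U[unfolded z0_def]])
    \<comment> \<open>On \<open>U\<close> the matrix \<open>G_mat\<close> is semidefinite and
      invertible, hence positive definite, so \<open>inv_sqrt\<close> has its intended meaning and
      the norm in the region equals \<open>T\<close>. Off \<open>U\<close> both sides are
      false.\<close>
    have C_iff: "well_defined_sample j \<iota> e V n (\<lambda>r. X r \<omega>) \<and> extrinsic_mean j Q \<in> C n (\<lambda>r. X r \<omega>) \<longleftrightarrow>
        avg n \<omega> \<in> U \<and> real n * T (avg n \<omega>) \<le> q" for n \<omega>
    proof (cases "avg n \<omega> \<in> U")
      case True
      then have "invertible (G_mat j \<iota> e n (\<lambda>r. X r \<omega>))"
        by (simp add: U_def G_avg)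
      then have pos: "0 < v \<bullet> (G_mat j \<iota> e n (\<lambda>r. X r \<omega>) *v v)" if "v \<noteq> 0" for v
        using that by (rule psd_invertible_imp_posdef[OF G_mat_symmetric G_mat_psd])
      have "T (avg n \<omega>) = (norm (inv_sqrt (G_mat j \<iota> e n (\<lambda>r. X r \<omega>)) *v
          tan_comp \<iota> e (c (sample_mean j n (\<lambda>r. X r \<omega>))) (proj j (sample_mean j n (\<lambda>r. X r \<omega>)) - \<nu>0)))\<^sup>2"
        unfolding T_def G_avg avg(1) t_def by (rule norm_inv_sqrt[OF G_mat_symmetric pos, symmetric])
      then show ?thesis
        using True C[of n "\<lambda>r. X r \<omega>"] by (simp add: wd)
    qed (simp add: wd)
    show ?thesis
      unfolding asymptotic_confidence_region_def C_iff cdf_q[symmetric]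
      using well lln delta by blast
  qed

  have "asymptotic_confidence_region P X (well_defined_sample j \<iota> e V)
      (region_C j \<iota> e V \<alpha>) (extrinsic_mean j Q) (1 - \<alpha>)"
  proof (rule region[of "\<lambda>_. \<nu>0"])
    \<comment> \<open>The restriction to \<open>V\<close> in \<open>region_C\<close> is met
      automatically, because the candidate point is \<nu>0 itself.\<close>
    show "extrinsic_mean j Q \<in> region_C j \<iota> e V \<alpha> n x \<longleftrightarrow>
        real n * (norm (inv_sqrt (G_mat j \<iota> e n x) *v
          tan_comp \<iota> e \<nu>0 (proj j (sample_mean j n x) - \<nu>0)))\<^sup>2 \<le> q" for n x
      using \<nu>0_V rangeI[of j "extrinsic_mean j Q"] by (simp add: region_C_def j_mean q_def)
  qed (use \<nu>0_V in auto)
  moreover have "asymptotic_confidence_region P X (well_defined_sample j \<iota> e V)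
      (region_D j \<iota> e \<alpha>) (extrinsic_mean j Q) (1 - \<alpha>)"
  proof (rule region[of "proj j"])
    show "extrinsic_mean j Q \<in> region_D j \<iota> e \<alpha> n x \<longleftrightarrow>
        real n * (norm (inv_sqrt (G_mat j \<iota> e n x) *v
          tan_comp \<iota> e (proj j (sample_mean j n x)) (proj j (sample_mean j n x) - \<nu>0)))\<^sup>2 \<le> q" for n x
      using rangeI[of j "extrinsic_mean j Q"] by (simp add: region_D_def j_mean q_def)
  qed (use cont_p in \<open>auto simp: \<nu>0_def W_def\<close>)
  ultimately show ?thesis ..
qed

end
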